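(* Let $q$ be a prime power, let $r$ be a prime integer and let $\mathcal{M}$ be an $\mathbb{F}_q$-subspace of $M_r(\mathbb{F}_q)$. Suppose that the determinantal polynomial of $\mathcal{M}$ is irreducible over $\mathbb{F}_q$ but not absolutely irreducible. Then the elements of determinant zero in $\mathcal{M}$ form a subspace of $\mathcal{M}$.
   Context: $M_n(K)$ is the $K$-vector space of $n\times n$ matrices over a field $K$. For a $d$-dimensional subspace $\mathcal{M}$ of $M_n(K)$, $d\ge 1$, with basis $M_1,\dots,M_d$, the determinantal polynomial of $\mathcal{M}$ (with respect to this basis) is $P_{\mathcal{M}}(x_1,\dots,x_d)=\det(x_1M_1+\cdots+x_dM_d)\in K[x_1,\dots,x_d]$. A change of basis changes $P_{\mathcal{M}}$ by an invertible linear change of variables, so irreducibility and absolute irreducibility do not depend on the basis. A polynomial over $\mathbb{F}_q$ is irreducible if it is irreducible in $\mathbb{F}_q[x_1,\dots,x_d]$, and absolutely irreducible if it is irreducible over the algebraic closure $\overline{\mathbb{F}}_q$. *)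

theory Defs
  imports "HOL-Analysis.Analysis" "HOL-Library.Poly_Mapping" "HOL-Algebra.Algebraic_Closure_Type"
begin

definition mat_scale :: "'a::times \<Rightarrow> 'a ^ 'n ^ 'm \<Rightarrow> 'a ^ 'n ^ 'm"  (infixr \<open>*\<^sub>m\<close> 75)
  where "c *\<^sub>m A = (\<chi> i j. c * A $ i $ j)"

interpretation mat_space: vector_space
  "mat_scale :: 'a::field \<Rightarrow> 'a ^ 'n ^ 'm \<Rightarrow> 'a ^ 'n ^ 'm"
  by unfold_locales (simp_all add: mat_scale_def vec_eq_iff algebra_simps)

text \<open>
  The ring \<open>('d, 'a) mpoly\<close> is the monoid algebra over \<open>'a\<close> of the finitely supported exponent
  functions \<open>'d \<Rightarrow>\<^sub>0 nat\<close>. For a finite type \<open>'d\<close> with \<open>d\<close> elements this is exactly the polynomial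
  ring in the \<open>d\<close> variables indexed by \<open>'d\<close>.
\<close>

type_synonym ('d, 'a) mpoly = "('d \<Rightarrow>\<^sub>0 nat) \<Rightarrow>\<^sub>0 'a"

definition Const :: "'a::zero \<Rightarrow> ('d, 'a) mpoly"
  where "Const c = Poly_Mapping.single 0 c"

definition Var :: "'d \<Rightarrow> ('d, 'a::zero_neq_one) mpoly"
  where "Var k = Poly_Mapping.single (Poly_Mapping.single k 1) 1"

definition determinantal_poly ::
  "('d::finite \<Rightarrow> 'a::comm_ring_1 ^ 'n ^ 'n) \<Rightarrow> ('d, 'a) mpoly"
  where "determinantal_poly B = det (\<Sum>k\<in>UNIV. Var k *\<^sub>m map_matrix Const (B k))"

text \<open>
  Since \<open>to_ac\<close> maps 0 to 0, \<open>Poly_Mapping.map to_ac\<close> is the coefficientwise embedding of the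
  polynomial ring over \<open>'a\<close> into the one over its algebraic closure.
\<close>

definition absolutely_irreducible :: "('d, 'a::field) mpoly \<Rightarrow> bool"
  where "absolutely_irreducible p \<longleftrightarrow>
    Factorial_Ring.irreducible (Poly_Mapping.map to_ac p :: ('d, 'a alg_closure) mpoly)"

definition is_basis_of :: "('d \<Rightarrow> 'a::field ^ 'n ^ 'm) \<Rightarrow> ('a ^ 'n ^ 'm) set \<Rightarrow> bool"
  where "is_basis_of B S \<longleftrightarrow>
    inj B \<and> mat_space.independent (range B) \<and> mat_space.span (range B) = S"

end

theory Submission
  imports Defs
begin

text \<open>
  Over the algebraic closure take an irreducible factor \<open>f\<close> of the determinantal polynomial \<open>P\<close>, scaled
  so that one coefficient is 1. Its conjugates under \<open>x \<mapsto> x\<^sup>q\<close> on coefficients are pairwise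
  non-associated prime divisors of \<open>P\<close>, so the product over an orbit of length \<open>n\<close> divides \<open>P\<close>. This
  product has coefficients in the base field, where \<open>P\<close> is irreducible, so it equals \<open>P\<close> up to a constant
  and the degree \<open>r\<close> of \<open>P\<close> is \<open>n\<close> times that of \<open>f\<close>. As \<open>P\<close> is reducible over the closure, \<open>f\<close> has degree
  less than the prime \<open>r\<close>, hence degree 1. At points of the base field the conjugates of \<open>f\<close> take
  conjugate values, so \<open>P\<close> vanishes exactly where the linear form \<open>f\<close> does.

  Primality of \<open>f\<close> needs unique factorization in several variables. The number of variables cannot
  vary within the type, so the induction on it runs over subrings of a single polynomial ring.
\<close>

section \<open>Gauss's lemma for subrings of an integral domain\<close>

hide_const (open) up_ring.coeff up_ring.monom Poly_Mapping.degree Polynomials.degree Polynomials.lead_coeff module.smult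

section \<open>Divisibility, units, primes and factoriality relative to a subring\<close>

definition dvd_in :: "'a::idom set \<Rightarrow> 'a \<Rightarrow> 'a \<Rightarrow> bool"
  where "dvd_in S a b \<longleftrightarrow> (\<exists>c\<in>S. b = a * c)"

definition unit_in :: "'a::idom set \<Rightarrow> 'a \<Rightarrow> bool"
  where "unit_in S a \<longleftrightarrow> a \<in> S \<and> dvd_in S a 1"

definition irreducible_in :: "'a::idom set \<Rightarrow> 'a \<Rightarrow> bool"
  where "irreducible_in S p \<longleftrightarrow> p \<in> S \<and> p \<noteq> 0 \<and> \<not> unit_in S p \<and>
    (\<forall>a\<in>S. \<forall>b\<in>S. p = a * b \<longrightarrow> unit_in S a \<or> unit_in S b)"

definition prime_in :: "'a::idom set \<Rightarrow> 'a \<Rightarrow> bool"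
  where "prime_in S p \<longleftrightarrow> p \<in> S \<and> p \<noteq> 0 \<and> \<not> unit_in S p \<and>
    (\<forall>a\<in>S. \<forall>b\<in>S. dvd_in S p (a * b) \<longrightarrow> dvd_in S p a \<or> dvd_in S p b)"

text \<open>Primes instead of irreducibles: for a subring uniqueness is then automatic, so this is
  the usual notion of a factorial ring. Units are the case of an empty list.\<close>

definition factorial_in :: "'a::idom set \<Rightarrow> bool"
  where "factorial_in S \<longleftrightarrow> (\<forall>a\<in>S. a \<noteq> 0 \<longrightarrow>
    (\<exists>u ps. unit_in S u \<and> (\<forall>p\<in>set ps. prime_in S p) \<and> a = u * prod_list ps))"

definition polys_over :: "'a::zero set \<Rightarrow> 'a poly set"
  where "polys_over S = {p. \<forall>n. coeff p n \<in> S}"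

locale idom_subring =
  fixes S :: "'a::idom set"
  assumes one_mem: "1 \<in> S"
    and diff_mem: "\<And>a b. a \<in> S \<Longrightarrow> b \<in> S \<Longrightarrow> a - b \<in> S"
    and mult_mem: "\<And>a b. a \<in> S \<Longrightarrow> b \<in> S \<Longrightarrow> a * b \<in> S"
begin

lemma zero_mem: "0 \<in> S"
  using diff_mem[OF one_mem one_mem] by simp

lemma add_mem: "a \<in> S \<Longrightarrow> b \<in> S \<Longrightarrow> a + b \<in> S"
  using diff_mem[of a "0 - b"] diff_mem[of 0 b] zero_mem by simp

lemma sum_mem: "(\<And>i. i \<in> I \<Longrightarrow> f i \<in> S) \<Longrightarrow> sum f I \<in> S"
  by (induction I rule: infinite_finite_induct) (auto simp: zero_mem add_mem)

lemma prod_list_mem: "set xs \<subseteq> S \<Longrightarrow> prod_list xs \<in> S"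
  by (induction xs) (auto simp: one_mem mult_mem)

lemma idom_subring_polys_over: "idom_subring (polys_over S)"
proof
  show "1 \<in> polys_over S"
    by (auto simp: polys_over_def coeff_1 one_mem zero_mem)
qed (auto simp: polys_over_def coeff_mult diff_mem intro!: sum_mem mult_mem)

lemma const_mem_polys_over [simp]: "[:c:] \<in> polys_over S \<longleftrightarrow> c \<in> S"
  by (auto simp: polys_over_def coeff_pCons zero_mem split: nat.splits dest: spec[of _ 0])

lemma monom_mem_polys_over: "c \<in> S \<Longrightarrow> monom c n \<in> polys_over S"
  by (auto simp: polys_over_def coeff_monom zero_mem)

lemma smult_mem_polys_over: "c \<in> S \<Longrightarrow> p \<in> polys_over S \<Longrightarrow> smult c p \<in> polys_over S"
  by (auto simp: polys_over_def mult_mem)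

lemma dvd_in_mult_right: "dvd_in S a b \<Longrightarrow> c \<in> S \<Longrightarrow> dvd_in S a (b * c)"
  unfolding dvd_in_def using mult_mem by (metis mult.assoc)

lemma dvd_in_mult_left: "dvd_in S a b \<Longrightarrow> c \<in> S \<Longrightarrow> dvd_in S a (c * b)"
  using dvd_in_mult_right[of a b c] by (simp add: mult.commute)

lemma dvd_in_diff: "dvd_in S a b \<Longrightarrow> dvd_in S a c \<Longrightarrow> dvd_in S a (b - c)"
  unfolding dvd_in_def using diff_mem by (metis right_diff_distrib)

lemma dvd_in_sum: "(\<And>i. i \<in> I \<Longrightarrow> dvd_in S a (f i)) \<Longrightarrow> dvd_in S a (sum f I)"
proof -
  assume "\<And>i. i \<in> I \<Longrightarrow> dvd_in S a (f i)"
  then obtain g where g: "\<And>i. i \<in> I \<Longrightarrow> g i \<in> S \<and> f i = a * g i"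
    unfolding dvd_in_def by metis
  then have "sum f I = a * sum g I"
    by (simp add: sum_distrib_left)
  then show ?thesis
    unfolding dvd_in_def using sum_mem[of I g] g by blast
qed

lemma unit_inE:
  assumes "unit_in S u"
  obtains v where "u \<in> S" "v \<in> S" "u * v = 1"
  using assms unfolding unit_in_def dvd_in_def by metis

lemma unit_inI: "u \<in> S \<Longrightarrow> v \<in> S \<Longrightarrow> u * v = 1 \<Longrightarrow> unit_in S u"
  unfolding unit_in_def dvd_in_def by metis

lemma irreducible_inD:
  assumes "irreducible_in S p"
  shows "p \<in> S" "p \<noteq> 0" "\<not> unit_in S p"
    and "a \<in> S \<Longrightarrow> b \<in> S \<Longrightarrow> p = a * b \<Longrightarrow> unit_in S a \<or> unit_in S b"
  using assms unfolding irreducible_in_def by blast+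

lemma prime_inD:
  assumes "prime_in S p"
  shows "p \<in> S" "p \<noteq> 0" "\<not> unit_in S p"
    and "a \<in> S \<Longrightarrow> b \<in> S \<Longrightarrow> dvd_in S p (a * b) \<Longrightarrow> dvd_in S p a \<or> dvd_in S p b"
  using assms unfolding prime_in_def by blast+

lemma prime_in_mult_unit:
  assumes "prime_in S p" "unit_in S u"
  shows "prime_in S (p * u)"
proof -
  from assms(2) obtain v where v: "u \<in> S" "v \<in> S" "u * v = 1"
    by (rule unit_inE)
  have eq: "dvd_in S (p * u) a \<longleftrightarrow> dvd_in S p a" for a
  proof
    assume "dvd_in S p a"
    then obtain c where "c \<in> S" "a = p * c" unfolding dvd_in_def by blast
    then have "a = p * u * (v * c)" "v * c \<in> S"
      using v mult_mem by (simp_all add: mult.assoc[symmetric] mult.assoc[of p u v])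
    then show "dvd_in S (p * u) a" unfolding dvd_in_def by blast
  next
    assume "dvd_in S (p * u) a"
    then show "dvd_in S p a"
      unfolding dvd_in_def using v mult_mem by (metis mult.assoc)
  qed
  have "u \<noteq> 0" using v by auto
  with assms v show ?thesis
    unfolding prime_in_def unit_in_def eq by (auto simp: mult_mem)
qed

text \<open>An irreducible \<open>c\<close> is not a unit, so its factorization contains some prime
  \<open>p\<close>; the cofactor of \<open>p\<close> must be a unit, and \<open>c\<close> is an
  associate of \<open>p\<close>.\<close>

lemma irreducible_in_imp_prime_in:
  assumes "factorial_in S" "irreducible_in S c"
  shows "prime_in S c"
proof -
  have c: "c \<in> S" "c \<noteq> 0" "\<not> unit_in S c"
    and irr: "\<And>a b. a \<in> S \<Longrightarrow> b \<in> S \<Longrightarrow> c = a * b \<Longrightarrow> unit_in S a \<or> unit_in S b"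
    using assms(2) unfolding irreducible_in_def by auto
  obtain u ps where u: "unit_in S u" "\<forall>p\<in>set ps. prime_in S p" "c = u * prod_list ps"
    using assms(1) c unfolding factorial_in_def by blast
  show ?thesis
  proof (cases ps)
    case Nil
    then show ?thesis using u c by simp
  next
    case (Cons p qs)
    have "set qs \<subseteq> S" using u Cons unfolding prime_in_def by auto
    then have "u * prod_list qs \<in> S"
      using u prod_list_mem mult_mem unfolding unit_in_def by blast
    moreover have "p \<in> S" "\<not> unit_in S p" "prime_in S p"
      using u Cons unfolding prime_in_def by auto
    moreover have "c = p * (u * prod_list qs)"
      using u Cons by (simp add: mult_ac)
    ultimately show ?thesis
      using irr prime_in_mult_unit by metis
  qed
qed

section \<open>Constants inside the polynomial ring over \<open>S\<close>\<close>

lemma dvd_in_polys_over_const_iff: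
  assumes "c \<noteq> 0"
  shows "dvd_in (polys_over S) [:c:] p \<longleftrightarrow> (\<forall>n. dvd_in S c (coeff p n))"
proof
  assume "dvd_in (polys_over S) [:c:] p"
  then obtain q where "q \<in> polys_over S" "p = [:c:] * q"
    unfolding dvd_in_def by blast
  then show "\<forall>n. dvd_in S c (coeff p n)"
    unfolding dvd_in_def polys_over_def by auto
next
  assume *: "\<forall>n. dvd_in S c (coeff p n)"
  then have "[:c:] dvd p"
    unfolding const_poly_dvd_iff dvd_in_def by (metis dvd_triv_left)
  then obtain q where q: "p = [:c:] * q" by blast
  have "coeff q n \<in> S" for n
  proof -
    obtain d where "d \<in> S" "coeff p n = c * d"
      using * unfolding dvd_in_def by blast
    then show ?thesis using q assms by simp
  qed
  then show "dvd_in (polys_over S) [:c:] p"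
    unfolding dvd_in_def polys_over_def using q by blast
qed

lemma unit_in_const_polys_over_iff: "unit_in (polys_over S) [:a:] \<longleftrightarrow> unit_in S a"
proof
  assume "unit_in (polys_over S) [:a:]"
  then obtain q where q: "a \<in> S" "q \<in> polys_over S" "[:a:] * q = 1"
    unfolding unit_in_def dvd_in_def by auto
  then have "coeff ([:a:] * q) 0 = 1" by simp
  then have "a * coeff q 0 = 1" by simp
  moreover have "coeff q 0 \<in> S" using q(2) unfolding polys_over_def by blast
  ultimately show "unit_in S a" using q(1) by (intro unit_inI)
next
  assume "unit_in S a"
  then obtain v where "a \<in> S" "v \<in> S" "a * v = 1" by (rule unit_inE)
  then show "unit_in (polys_over S) [:a:]"
    by (intro idom_subring.unit_inI[OF idom_subring_polys_over, of _ "[:v:]"])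
      (simp_all add: one_pCons mult.commute)
qed

text \<open>Gauss's argument: if \<open>c\<close> divides neither \<open>f\<close> nor
  \<open>g\<close>, take the least indices \<open>i\<close> and \<open>j\<close> of coefficients not
  divisible by \<open>c\<close>. The coefficient of \<open>f * g\<close> at \<open>i + j\<close> is
  then not divisible by \<open>c\<close> either.\<close>

lemma prime_in_const_polys_over:
  assumes "prime_in S c"
  shows "prime_in (polys_over S) [:c:]"
proof -
  have c: "c \<in> S" "c \<noteq> 0" "\<not> unit_in S c"
    and pr: "\<And>a b. a \<in> S \<Longrightarrow> b \<in> S \<Longrightarrow> dvd_in S c (a * b) \<Longrightarrow> dvd_in S c a \<or> dvd_in S c b"
    using assms unfolding prime_in_def by auto
  note dvd_iff = dvd_in_polys_over_const_iff[OF c(2)]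
  have "\<not> unit_in (polys_over S) [:c:]"
    using c unfolding unit_in_def dvd_iff by (auto dest: spec[of _ 0])
  moreover have "dvd_in (polys_over S) [:c:] f \<or> dvd_in (polys_over S) [:c:] g"
    if fg: "f \<in> polys_over S" "g \<in> polys_over S" "dvd_in (polys_over S) [:c:] (f * g)" for f g
  proof (rule ccontr)
    assume "\<not> ?thesis"
    then obtain i0 j0 where ij0: "\<not> dvd_in S c (coeff f i0)" "\<not> dvd_in S c (coeff g j0)"
      unfolding dvd_iff by blast
    define i where "i = (LEAST i. \<not> dvd_in S c (coeff f i))"
    define j where "j = (LEAST j. \<not> dvd_in S c (coeff g j))"
    have i: "\<not> dvd_in S c (coeff f i)" and i_min: "\<And>k. k < i \<Longrightarrow> dvd_in S c (coeff f k)"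
      unfolding i_def using LeastI[of "\<lambda>i. \<not> dvd_in S c (coeff f i)", OF ij0(1)]
      by (blast dest: not_less_Least)+
    have j: "\<not> dvd_in S c (coeff g j)" and j_min: "\<And>k. k < j \<Longrightarrow> dvd_in S c (coeff g k)"
      unfolding j_def using LeastI[of "\<lambda>j. \<not> dvd_in S c (coeff g j)", OF ij0(2)]
      by (blast dest: not_less_Least)+
    have mem: "coeff f k \<in> S" "coeff g k \<in> S" for k
      using fg unfolding polys_over_def by auto
    \<comment> \<open>In every other term of the convolution one of the two indices lies below its
      bound \<open>i\<close> or \<open>j\<close>, so \<open>c\<close> divides that term.\<close>
    have rest: "dvd_in S c (\<Sum>k\<in>{..i+j}-{i}. coeff f k * coeff g (i + j - k))"
    proof (rule dvd_in_sum)
      fix k assume "k \<in> {..i+j}-{i}"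
      then consider "k < i" | "i + j - k < j" by force
      then show "dvd_in S c (coeff f k * coeff g (i + j - k))"
        by cases (use i_min j_min mem dvd_in_mult_left dvd_in_mult_right in auto)
    qed
    have "dvd_in S c (coeff (f * g) (i + j))"
      using fg(3) unfolding dvd_iff by blast
    also have "coeff (f * g) (i + j) = coeff f i * coeff g j +
        (\<Sum>k\<in>{..i+j}-{i}. coeff f k * coeff g (i + j - k))"
      by (subst coeff_mult, subst sum.remove[of _ i]) auto
    finally have "dvd_in S c (coeff f i * coeff g j)"
      using dvd_in_diff[OF _ rest] by fastforce
    then show False using pr mem i j by blast
  qed
  ultimately show ?thesis
    using c unfolding prime_in_def by simp
qed

text \<open>Euclidean division without inverting the leading coefficient of \<open>g\<close>:
  multiplying \<open>f\<close> by it lets the leading term be cancelled by a multiple of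
  \<open>g\<close>, and \<open>c\<close> accumulates these factors.\<close>

lemma pseudo_division:
  assumes "g \<in> polys_over S" "g \<noteq> 0" "f \<in> polys_over S"
  shows "\<exists>c\<in>S. \<exists>q\<in>polys_over S. \<exists>r\<in>polys_over S.
    c \<noteq> 0 \<and> [:c:] * f = g * q + r \<and> (r = 0 \<or> degree r < degree g)"
  using assms(3)
\<comment> \<open>The length of the coefficient list is 0 for the zero polynomial and the degree
  plus 1 otherwise, so it also drops when a nonzero constant is reduced to zero.\<close>
proof (induction "length (coeffs f)" arbitrary: f rule: less_induct)
  case less
  interpret P: idom_subring "polys_over S"
    by (rule idom_subring_polys_over)
  show ?case
  proof (cases "f = 0 \<or> degree f < degree g")
    case True
    then show ?thesis
      using less.prems P.zero_mem one_mem
      by (intro rev_bexI[OF one_mem] rev_bexI[OF P.zero_mem] rev_bexI[OF less.prems]) auto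
  next
    case False
    then have "f \<noteq> 0" and deg: "degree g \<le> degree f" by auto
    define a b m where "a = lead_coeff g" and "b = lead_coeff f"
      and "m = monom b (degree f - degree g)"
    define h where "h = [:a:] * f - g * m"
    have ab: "a \<in> S" "b \<in> S" "a \<noteq> 0" "b \<noteq> 0"
      using assms less.prems \<open>f \<noteq> 0\<close> unfolding a_def b_def polys_over_def by auto
    have m: "m \<in> polys_over S" unfolding m_def by (rule monom_mem_polys_over[OF ab(2)])
    have h: "h \<in> polys_over S"
      unfolding h_def using ab m assms less.prems by (intro P.diff_mem P.mult_mem) auto
    have degm: "degree (g * m) = degree f" 
      using ab assms deg Polynomial.degree_monom_eq[OF ab(4)] by (simp add: m_def degree_mult_eq)
    have "lead_coeff (g * m) = a * b"
      using Polynomial.degree_monom_eq[OF ab(4)] by (simp add: lead_coeff_mult a_def m_def)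
    then have "coeff h (degree f) = 0"
      using degm by (simp add: h_def b_def mult.commute)
    moreover have "degree h \<le> degree f"
      unfolding h_def using degm by (intro degree_diff_le) auto
    ultimately have "h = 0 \<or> degree h < degree f"
      by (metis le_neq_implies_less leading_coeff_0_iff)
    then have "length (coeffs h) < length (coeffs f)"
      using \<open>f \<noteq> 0\<close> by (cases "h = 0") (auto simp: length_coeffs_degree)
    from less.hyps[OF this h] obtain c q r where
      *: "c \<in> S" "q \<in> polys_over S" "r \<in> polys_over S" "c \<noteq> 0" "[:c:] * h = g * q + r"
         "r = 0 \<or> degree r < degree g"
      by (elim bexE conjE) (rule that)
    have "[:c * a:] * f = [:c:] * ([:a:] * f)" by (simp add: mult_ac)
    also have "\<dots> = [:c:] * h + [:c:] * (g * m)" 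
      unfolding h_def by (simp only: right_diff_distrib diff_add_cancel)
    also have "\<dots> = g * (q + [:c:] * m) + r" using *(5) by (simp add: algebra_simps)
    finally have "[:c * a:] * f = g * (q + [:c:] * m) + r" .
    moreover have "c * a \<in> S" "q + [:c:] * m \<in> polys_over S" "c * a \<noteq> 0"
      using * ab m by (simp_all add: mult_mem P.add_mem smult_mem_polys_over)
    ultimately show ?thesis
      using *(3,6) by (intro rev_bexI[of "c * a"] rev_bexI[of "q + [:c:] * m"] rev_bexI[of r]) auto
  qed
qed

text \<open>Clearing the denominator \<open>c\<close>: its prime factors stay prime in \<open>S[x]\<close>, so each of them
  divides \<open>Q\<close> or \<open>D\<close>.\<close>

lemma cancel_const_polys_over:
  assumes "factorial_in S" "c \<in> S" "c \<noteq> 0" "[:c:] * F = Q * D"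
    "Q \<in> polys_over S" "D \<in> polys_over S" "F \<in> polys_over S"
  obtains d Q' D' where "d \<in> S" "d \<noteq> 0" "Q' \<in> polys_over S" "D' \<in> polys_over S"
    "D = [:d:] * D'" "F = Q' * D'"
proof -
  interpret P: idom_subring "polys_over S"
    by (rule idom_subring_polys_over)
  obtain u ps where u: "unit_in S u" "\<forall>p\<in>set ps. prime_in S p" "c = u * prod_list ps"
    using assms unfolding factorial_in_def by blast
  have "\<exists>d\<in>S. \<exists>Q'\<in>polys_over S. \<exists>D'\<in>polys_over S. d \<noteq> 0 \<and> D = [:d:] * D' \<and> F = Q' * D'"
    using u(2) assms(4)[unfolded u(3)] assms(5,6)
  proof (induction ps arbitrary: Q D)
    case Nil
    obtain v where v: "u \<in> S" "v \<in> S" "u * v = 1" using u(1) by (rule unit_inE)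
    have "F = [:v:] * ([:u:] * F)" using v by (simp add: mult.commute)
    also have "\<dots> = [:v:] * Q * D" using Nil by (simp add: mult.assoc)
    finally show ?case
      using Nil v one_mem P.mult_mem[of "[:v:]" Q]
      by (intro rev_bexI[OF one_mem] bexI[of _ "[:v:] * Q"] bexI[of _ D]) auto
  next
    case (Cons p ps)
    let ?G = "[:u * prod_list ps:] * F"
    have p: "prime_in S p" "p \<in> S" "p \<noteq> 0" using Cons.prems(1) unfolding prime_in_def by auto
    have eq: "Q * D = [:p:] * ?G"
      using Cons.prems(2) by (simp add: mult_ac)
    have "u * prod_list ps \<in> S"
      using u(1) Cons.prems(1) unfolding unit_in_def prime_in_def
      by (intro mult_mem prod_list_mem) auto
    then have "?G \<in> polys_over S"
      using assms(7) by (intro P.mult_mem) auto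
    then have "dvd_in (polys_over S) [:p:] (Q * D)"
      unfolding eq dvd_in_def by blast
    then have "dvd_in (polys_over S) [:p:] Q \<or> dvd_in (polys_over S) [:p:] D"
      using prime_in_const_polys_over[OF p(1)] Cons.prems(3,4) unfolding prime_in_def by blast
    \<comment> \<open>If \<open>p\<close> divides \<open>Q\<close> it is cancelled there; if it
      divides \<open>D\<close> it is cancelled there and recorded as a factor of
      \<open>d\<close>.\<close>
    then show ?case
    proof
      assume "dvd_in (polys_over S) [:p:] Q"
      then obtain Q1 where Q1: "Q1 \<in> polys_over S" "Q = [:p:] * Q1" unfolding dvd_in_def by blast
      then have "[:p:] * ?G = [:p:] * (Q1 * D)" using eq by (simp only: mult.assoc)
      then have "?G = Q1 * D" using p by (metis mult_cancel_left pCons_eq_0_iff)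
      then show ?thesis
        using Cons.IH[of Q1 D] Cons.prems Q1 by simp
    next
      assume "dvd_in (polys_over S) [:p:] D"
      then obtain D1 where D1: "D1 \<in> polys_over S" "D = [:p:] * D1" unfolding dvd_in_def by blast
      then have "[:p:] * ?G = [:p:] * (Q * D1)" using eq by (simp only: mult.left_commute)
      then have "?G = Q * D1" using p by (metis mult_cancel_left pCons_eq_0_iff)
      then obtain d Q' D' where *: "d \<in> S" "Q' \<in> polys_over S" "D' \<in> polys_over S"
        "d \<noteq> 0" "D1 = [:d:] * D'" "F = Q' * D'"
        using Cons.IH[of Q D1] Cons.prems D1 by auto
      then have "D = [:p * d:] * D'" using D1 by (simp add: mult_ac)
      with * p show ?thesis
        by (intro bexI[of _ "p * d"] bexI[of _ Q'] bexI[of _ D']) (auto intro: mult_mem)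
    qed
  qed
  then show thesis using that by blast
qed

text \<open>Turns divisibility up to a denominator \<open>e\<close> into divisibility. Clearing
  \<open>e\<close> only moves a constant \<open>d\<close> out of \<open>F\<close>; the remaining
  factor \<open>F'\<close> has positive degree, so irreducibility makes \<open>d\<close> a unit and
  \<open>F'\<close> an associate of \<open>F\<close>.\<close>

lemma irreducible_dvd_in_cancel_const:
  assumes "factorial_in S" "irreducible_in (polys_over S) F" "degree F > 0"
    "e \<in> S" "e \<noteq> 0" "[:e:] * G = W * F" "W \<in> polys_over S" "G \<in> polys_over S"
  shows "dvd_in (polys_over S) F G"
proof -
  interpret P: idom_subring "polys_over S"
    by (rule idom_subring_polys_over)
  have F: "F \<in> polys_over S" "F \<noteq> 0"
    and irr: "\<And>a b. a \<in> polys_over S \<Longrightarrow> b \<in> polys_over S \<Longrightarrow> F = a * b \<Longrightarrow>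
      unit_in (polys_over S) a \<or> unit_in (polys_over S) b"
    using assms(2) unfolding irreducible_in_def by auto
  obtain d Q' F' where *: "d \<in> S" "d \<noteq> 0" "Q' \<in> polys_over S" "F' \<in> polys_over S"
    "F = [:d:] * F'" "G = Q' * F'"
    using cancel_const_polys_over[OF assms(1,4-7) F(1) assms(8)] by blast
  have "\<not> unit_in (polys_over S) F'"
  proof
    assume "unit_in (polys_over S) F'"
    then obtain v where "F' * v = 1" by (rule P.unit_inE)
    then have "degree F' = 0" by (metis degree_mult_eq_0 degree_1 mult_zero_left mult_zero_right zero_neq_one)
    then show False using assms(3) * by (simp add: degree_mult_eq)
  qed
  then have "unit_in (polys_over S) [:d:]"
    using irr * const_mem_polys_over by blast
  then obtain v where v: "v \<in> polys_over S" "[:d:] * v = 1" by (rule P.unit_inE)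
  then have "F' = F * v" using * by (metis mult.commute mult.left_commute mult_1)
  then have "G = F * (v * Q')" using *(6) by (simp only: mult_ac)
  then show ?thesis
    unfolding dvd_in_def using v * P.mult_mem by blast
qed

text \<open>A nonzero element \<open>D\<close> of minimal degree in the ideal generated by \<open>F\<close> and \<open>G\<close> is, up to a
  denominator in \<open>S\<close>, a common divisor of both.\<close>

theorem irreducible_in_polys_over_imp_prime_in:
  assumes fac: "factorial_in S" and F: "irreducible_in (polys_over S) F"
  shows "prime_in (polys_over S) F"
proof (cases "degree F = 0")
  case True
  then obtain c where c: "F = [:c:]" by (metis degree_eq_zeroE)
  have "irreducible_in S c"
    unfolding irreducible_in_def
  proof (intro conjI ballI impI)
    show "c \<in> S" "c \<noteq> 0" "\<not> unit_in S c"
      using F unfolding c irreducible_in_def unit_in_const_polys_over_iff by auto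
    fix a b assume ab: "a \<in> S" "b \<in> S" "c = a * b"
    then have "[:c:] = [:a:] * [:b:]" by simp
    then show "unit_in S a \<or> unit_in S b"
      using idom_subring.irreducible_inD(4)[OF idom_subring_polys_over F, of "[:a:]" "[:b:]"] ab unfolding c unit_in_const_polys_over_iff by simp
  qed
  then show ?thesis
    unfolding c by (intro prime_in_const_polys_over irreducible_in_imp_prime_in fac)
next
  case False
  then have deg: "degree F > 0" by simp
  interpret P: idom_subring "polys_over S"
    by (rule idom_subring_polys_over)
  have Fm: "F \<in> polys_over S" "F \<noteq> 0" "\<not> unit_in (polys_over S) F"
    and irr: "\<And>a b. a \<in> polys_over S \<Longrightarrow> b \<in> polys_over S \<Longrightarrow> F = a * b \<Longrightarrow>
      unit_in (polys_over S) a \<or> unit_in (polys_over S) b"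
    using F unfolding irreducible_in_def by auto
  note cancel = irreducible_dvd_in_cancel_const[OF fac F deg]
  have "dvd_in (polys_over S) F G \<or> dvd_in (polys_over S) F H"
    if G: "G \<in> polys_over S" and H: "H \<in> polys_over S"
      and dvd: "dvd_in (polys_over S) F (G * H)" for G H
  proof -
    define I where "I = {U * F + V * G |U V. U \<in> polys_over S \<and> V \<in> polys_over S}"
    have "1 * F + 0 * G \<in> I"
      unfolding I_def using P.one_mem P.zero_mem by blast
    then have FI: "F \<in> I - {0}" using Fm by simp
    define D where "D = arg_min degree (\<lambda>D. D \<in> I - {0})"
    have D: "D \<in> I" "D \<noteq> 0" and Dmin: "\<And>Y. Y \<in> I \<Longrightarrow> Y \<noteq> 0 \<Longrightarrow> degree D \<le> degree Y"
      using arg_min_natI[of "\<lambda>D. D \<in> I - {0}" F degree] FI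
        arg_min_nat_le[of "\<lambda>D. D \<in> I - {0}" _ degree]
      unfolding D_def by blast+
    obtain U V where UV: "U \<in> polys_over S" "V \<in> polys_over S" "D = U * F + V * G"
      using D(1) unfolding I_def by blast
    have Dm: "D \<in> polys_over S"
      using UV Fm G by (auto intro: P.add_mem P.mult_mem)
    \<comment> \<open>The remainder of \<open>Y\<close> under pseudo-division by \<open>D\<close>
      lies in \<open>I\<close> again and is zero or of smaller degree than \<open>D\<close>; by
      minimality it is zero.\<close>
    have div: "\<exists>c\<in>S. \<exists>q\<in>polys_over S. c \<noteq> 0 \<and> [:c:] * Y = q * D" if Y: "Y = A * F + B * G"
      "A \<in> polys_over S" "B \<in> polys_over S" for A B Y
    proof -
      have Ym: "Y \<in> polys_over S"
        using Y Fm G by (auto intro: P.add_mem P.mult_mem)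
      obtain c q r where *: "c \<in> S" "q \<in> polys_over S" "r \<in> polys_over S" "c \<noteq> 0"
        "[:c:] * Y = D * q + r" "r = 0 \<or> degree r < degree D"
        using pseudo_division[OF Dm D(2) Ym] by (elim bexE conjE) (rule that)
      have "r = [:c:] * Y - D * q" using *(5) by (metis add_diff_cancel_left')
      also have "\<dots> = ([:c:] * A - U * q) * F + ([:c:] * B - V * q) * G"
        unfolding Y UV(3) by (simp only: algebra_simps)
      also have "\<dots> \<in> I"
      proof -
        have "[:c:] * A - U * q \<in> polys_over S" "[:c:] * B - V * q \<in> polys_over S"
          using Y(2,3) UV(1,2) *(1,2) by (intro P.diff_mem P.mult_mem; simp)+
        then show ?thesis unfolding I_def by blast
      qed
      finally have "r = 0"
        using *(6) Dmin[of r] by force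
      then have "[:c:] * Y = q * D" using *(5) by (simp only: mult.commute add_0_right)
      then show ?thesis using *(1,2,4) by blast
    qed
    obtain c Q where c: "c \<in> S" "Q \<in> polys_over S" "c \<noteq> 0" "[:c:] * F = Q * D"
      using div[of F 1 0] P.one_mem P.zero_mem by force
    obtain e R where e: "e \<in> S" "R \<in> polys_over S" "e \<noteq> 0" "[:e:] * G = R * D"
      using div[of G 0 1] P.one_mem P.zero_mem by force
    obtain d Q' D' where *: "d \<in> S" "d \<noteq> 0" "Q' \<in> polys_over S" "D' \<in> polys_over S"
      "D = [:d:] * D'" "F = Q' * D'"
      using cancel_const_polys_over[OF fac c(1,3,4,2) Dm Fm(1)] by blast
    \<comment> \<open>Since \<open>F = Q' * D'\<close>, one factor is a unit. If it is
      \<open>Q'\<close>, then \<open>D'\<close> is an associate of \<open>F\<close>, and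
      \<open>F\<close> divides \<open>[:e:] * G\<close>; if it is \<open>D'\<close>, then
      \<open>D\<close> is an associate of \<open>[:d:]\<close>, and \<open>F\<close> divides
      \<open>[:d:] * H\<close>.\<close>
    from irr[OF *(3,4,6)] show ?thesis
    proof
      assume "unit_in (polys_over S) Q'"
      then obtain v where v: "v \<in> polys_over S" "Q' * v = 1" by (rule P.unit_inE)
      then have D'_eq: "D' = v * F" using * by (metis mult.assoc mult.commute mult_1)
      have "[:e:] * G = R * ([:d:] * D')" using e(4) *(5) by (simp only:)
      also have "\<dots> = (R * [:d:] * v) * F" by (subst D'_eq) (simp only: mult_ac)
      finally have "[:e:] * G = (R * [:d:] * v) * F" .
      moreover have "R * [:d:] * v \<in> polys_over S"
        using e v * by (intro P.mult_mem) auto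
      ultimately show ?thesis using cancel e G by blast
    next
      assume "unit_in (polys_over S) D'"
      then obtain v where v: "v \<in> polys_over S" "D' * v = 1" by (rule P.unit_inE)
      obtain W where W: "W \<in> polys_over S" "G * H = F * W"
        using dvd unfolding dvd_in_def by blast
      have "[:d:] = D * v" using * v by (simp add: mult.assoc)
      \<comment> \<open>Multiplying \<open>D = U * F + V * G\<close> by \<open>H\<close> leaves a
        multiple of \<open>F\<close>, because \<open>F\<close> divides \<open>G * H\<close>.\<close>
      then have "[:d:] * H = v * (U * F * H + V * (G * H))"
        unfolding UV(3) by (simp only: algebra_simps)
      also have "\<dots> = (v * (U * H + V * W)) * F"
        unfolding W(2) by (simp only: algebra_simps)
      finally have "[:d:] * H = (v * (U * H + V * W)) * F" .
      moreover have "v * (U * H + V * W) \<in> polys_over S"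
        using v UV W H by (intro P.mult_mem P.add_mem) auto
      ultimately show ?thesis using cancel * H by blast
    qed
  qed
  then show ?thesis
    using Fm unfolding prime_in_def by blast
qed

end

section \<open>Evaluation and total degree of multivariate polynomials\<close>

locale ring_morphism =
  fixes h :: "'a::comm_ring_1 \<Rightarrow> 'b::comm_ring_1"
  assumes add: "h (a + b) = h a + h b"
    and mult: "h (a * b) = h a * h b"
    and one: "h 1 = 1"
begin

lemma zero: "h 0 = 0"
  using add[of 0 0] by simp

lemma uminus: "h (- a) = - h a"
  using add[of a "- a"] zero by (simp add: minus_unique)

lemma diff: "h (a - b) = h a - h b"
  using add[of a "- b"] uminus by simp

lemma sum: "h (sum f A) = (\<Sum>i\<in>A. h (f i))"
  by (induction A rule: infinite_finite_induct) (auto simp: zero add)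

lemma prod: "h (prod f A) = (\<Prod>i\<in>A. h (f i))"
  by (induction A rule: infinite_finite_induct) (auto simp: one mult)

lemma power: "h (a ^ n) = h a ^ n"
  by (induction n) (auto simp: one mult)

lemma of_nat: "h (of_nat n) = of_nat n"
  by (induction n) (auto simp: zero one add)

lemma of_int: "h (of_int k) = of_int k"
  by (cases k) (auto simp: of_nat uminus one diff)

lemma det: "h (det A) = det (\<chi> i j. h (A $ i $ j))"
  unfolding det_def by (simp add: sum mult prod of_int)

end

lemma ring_morphism_id: "ring_morphism (\<lambda>a. a)"
  by unfold_locales auto

lemma ring_morphism_comp:
  assumes "ring_morphism f" "ring_morphism g"
  shows "ring_morphism (\<lambda>a. f (g a))"
proof -
  interpret f: ring_morphism f by fact
  interpret g: ring_morphism g by fact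
  show ?thesis by unfold_locales (auto simp: f.add g.add f.mult g.mult f.one g.one)
qed

lemma ring_morphism_const_poly: "ring_morphism (\<lambda>a. [:a:])"
  by unfold_locales (auto simp: one_pCons)

lemma ring_morphism_poly: "ring_morphism (\<lambda>p. poly p a)"
  by unfold_locales auto

lemma ring_morphism_Const: "ring_morphism (Const :: 'a::comm_ring_1 \<Rightarrow> ('i, 'a) mpoly)"
  by unfold_locales (auto simp: Const_def single_add mult_single)

section \<open>Evaluation homomorphisms\<close>

definition monomial_value :: "('i \<Rightarrow> 'b::comm_ring_1) \<Rightarrow> ('i \<Rightarrow>\<^sub>0 nat) \<Rightarrow> 'b"
  where "monomial_value x m = (\<Prod>i\<in>Poly_Mapping.keys m. x i ^ Poly_Mapping.lookup m i)"

text \<open>Special choices of \<open>\<phi>\<close> and \<open>x\<close> give evaluation at points,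
  change of coefficients, renaming of variables, grading and isolating one variable.\<close>

definition eval_mpoly :: "('a::zero \<Rightarrow> 'b::comm_ring_1) \<Rightarrow> ('i \<Rightarrow> 'b) \<Rightarrow> ('i, 'a) mpoly \<Rightarrow> 'b"
  where "eval_mpoly \<phi> x p =
    (\<Sum>m\<in>Poly_Mapping.keys p. \<phi> (Poly_Mapping.lookup p m) * monomial_value x m)"

lemma monomial_value_superset:
  assumes "finite A" "Poly_Mapping.keys m \<subseteq> A"
  shows "monomial_value x m = (\<Prod>i\<in>A. x i ^ Poly_Mapping.lookup m i)"
  unfolding monomial_value_def using assms
  by (intro prod.mono_neutral_left) (auto simp: in_keys_iff)

lemma monomial_value_add: "monomial_value x (m + n) = monomial_value x m * monomial_value x n"
proof -
  let ?A = "Poly_Mapping.keys m \<union> Poly_Mapping.keys n"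
  have "monomial_value x (m + n) = (\<Prod>i\<in>?A. x i ^ Poly_Mapping.lookup (m + n) i)"
    by (intro monomial_value_superset) (auto simp: keys_add)
  also have "\<dots> = monomial_value x m * monomial_value x n"
    by (simp add: lookup_add power_add prod.distrib monomial_value_superset[of ?A])
  finally show ?thesis .
qed

lemma monomial_value_zero [simp]: "monomial_value x 0 = 1"
  by (simp add: monomial_value_def)

lemma monomial_value_single [simp]: "monomial_value x (Poly_Mapping.single i k) = x i ^ k"
  by (cases "k = 0") (simp_all add: monomial_value_def)

lemma (in ring_morphism) monomial_value: "h (monomial_value x m) = monomial_value (\<lambda>i. h (x i)) m"
  by (simp add: monomial_value_def prod power)

lemma (in ring_morphism) eval_mpoly:
  "h (eval_mpoly \<phi> x p) = eval_mpoly (\<lambda>c. h (\<phi> c)) (\<lambda>i. h (x i)) p"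
  by (simp add: eval_mpoly_def sum mult monomial_value)

lemma mpoly_expand:
  "p = (\<Sum>m\<in>Poly_Mapping.keys p. Poly_Mapping.single m (Poly_Mapping.lookup p m))"
proof (rule poly_mapping_eqI)
  fix m
  have "(\<Sum>n\<in>Poly_Mapping.keys p. Poly_Mapping.lookup p n when n = m) = Poly_Mapping.lookup p m"
    by (simp add: when_def sum.delta' in_keys_iff)
  then show "Poly_Mapping.lookup p m = Poly_Mapping.lookup
    (\<Sum>m\<in>Poly_Mapping.keys p. Poly_Mapping.single m (Poly_Mapping.lookup p m)) m"
    by (simp add: lookup_sum lookup_single)
qed

lemma mpoly_induct [case_names single add]:
  fixes p :: "('i, 'a::comm_ring_1) mpoly"
  assumes "\<And>m c. P (Poly_Mapping.single m c)" "\<And>p q. P p \<Longrightarrow> P q \<Longrightarrow> P (p + q)"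
  shows "P p"
proof -
  have "P (\<Sum>m\<in>A. Poly_Mapping.single m (Poly_Mapping.lookup p m))" for A
    by (induction A rule: infinite_finite_induct)
      (use assms(1)[of 0 0] in \<open>auto intro: assms\<close>)
  then show ?thesis using mpoly_expand[of p] by metis
qed

lemma monomial_value_Var: "monomial_value Var m = (Poly_Mapping.single m 1 :: ('i, 'a::comm_ring_1) mpoly)"
proof -
  have pow: "Var i ^ k = (Poly_Mapping.single (Poly_Mapping.single i k) 1 :: ('i, 'a) mpoly)" for i k
    by (induction k) (auto simp: Var_def mult_single single_add[symmetric])
  have "(\<Prod>i\<in>A. Poly_Mapping.single (f i) 1) = (Poly_Mapping.single (sum f A) 1 :: ('i, 'a) mpoly)"
    for A :: "'i set" and f
    by (induction A rule: infinite_finite_induct) (auto simp: mult_single)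
  then show ?thesis
    using mpoly_expand[of m] by (simp add: monomial_value_def pow)
qed

lemma single_eq_Const_mult:
  "Poly_Mapping.single m c = Const c * monomial_value Var m" for c :: "'a::comm_ring_1"
  by (simp add: monomial_value_Var Const_def mult_single)

lemma eval_mpoly_Const_Var: "eval_mpoly Const Var p = p" for p :: "('i, 'a::comm_ring_1) mpoly"
  using mpoly_expand[of p] by (simp add: eval_mpoly_def single_eq_Const_mult)

lemma eval_mpoly_cong:
  assumes "\<And>m i. m \<in> Poly_Mapping.keys p \<Longrightarrow> i \<in> Poly_Mapping.keys m \<Longrightarrow> x i = y i"
  shows "eval_mpoly \<phi> x p = eval_mpoly \<phi> y p"
  unfolding eval_mpoly_def monomial_value_def using assms by (intro sum.cong prod.cong) auto

context
  fixes \<phi> :: "'a::comm_ring_1 \<Rightarrow> 'b::comm_ring_1" and x :: "'i \<Rightarrow> 'b"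
  assumes \<phi>: "ring_morphism \<phi>"
begin

interpretation \<phi>: ring_morphism \<phi> by (rule \<phi>)

lemma eval_mpoly_superset:
  assumes "finite A" "Poly_Mapping.keys p \<subseteq> A"
  shows "eval_mpoly \<phi> x p = (\<Sum>m\<in>A. \<phi> (Poly_Mapping.lookup p m) * monomial_value x m)"
  unfolding eval_mpoly_def using assms
  by (intro sum.mono_neutral_left) (auto simp: in_keys_iff \<phi>.zero)

lemma eval_mpoly_single: "eval_mpoly \<phi> x (Poly_Mapping.single m c) = \<phi> c * monomial_value x m"
  by (simp add: eval_mpoly_superset[of "{m}"])

lemma eval_mpoly_Const: "eval_mpoly \<phi> x (Const c) = \<phi> c"
  by (simp add: Const_def eval_mpoly_single)

lemma eval_mpoly_Var: "eval_mpoly \<phi> x (Var i) = x i"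
  by (simp add: Var_def eval_mpoly_single \<phi>.one)

lemma eval_mpoly_add: "eval_mpoly \<phi> x (p + q) = eval_mpoly \<phi> x p + eval_mpoly \<phi> x q"
proof -
  let ?A = "Poly_Mapping.keys p \<union> Poly_Mapping.keys q"
  have "eval_mpoly \<phi> x (p + q) = (\<Sum>m\<in>?A. \<phi> (Poly_Mapping.lookup (p + q) m) * monomial_value x m)"
    by (intro eval_mpoly_superset) (auto simp: keys_add)
  also have "\<dots> = eval_mpoly \<phi> x p + eval_mpoly \<phi> x q"
    by (simp add: lookup_add \<phi>.add distrib_right sum.distrib eval_mpoly_superset[of ?A])
  finally show ?thesis .
qed

lemma eval_mpoly_mult: "eval_mpoly \<phi> x (p * q) = eval_mpoly \<phi> x p * eval_mpoly \<phi> x q"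
proof (induction p rule: mpoly_induct)
  case (single m c)
  show ?case
    by (induction q rule: mpoly_induct)
      (auto simp: mult_single eval_mpoly_single \<phi>.mult monomial_value_add eval_mpoly_add algebra_simps)
qed (simp add: eval_mpoly_add distrib_right)

lemma ring_morphism_eval_mpoly: "ring_morphism (eval_mpoly \<phi> x)"
  using eval_mpoly_Const[of 1] by unfold_locales
    (auto simp: eval_mpoly_add eval_mpoly_mult \<phi>.one Const_def)

end

lemma lookup_map:
  "f 0 = 0 \<Longrightarrow> Poly_Mapping.lookup (Poly_Mapping.map f p) m = f (Poly_Mapping.lookup p m)"
  by (simp add: map.rep_eq when_def)

text \<open>Written as an evaluation, coefficientwise application inherits the homomorphism laws of
  \<open>eval_mpoly\<close>.\<close>

lemma map_eq_eval_mpoly: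
  fixes f :: "'a::comm_ring_1 \<Rightarrow> 'b::comm_ring_1"
  assumes "ring_morphism f"
  shows "Poly_Mapping.map f p = eval_mpoly (\<lambda>c. Const (f c)) Var p"
proof -
  interpret f: ring_morphism f by fact
  have "Poly_Mapping.map f p = (\<Sum>m\<in>Poly_Mapping.keys p. Poly_Mapping.single m (f (Poly_Mapping.lookup p m)))"
  proof (rule poly_mapping_eqI)
    fix m
    show "Poly_Mapping.lookup (Poly_Mapping.map f p) m = Poly_Mapping.lookup
      (\<Sum>m\<in>Poly_Mapping.keys p. Poly_Mapping.single m (f (Poly_Mapping.lookup p m))) m"
      by (simp add: lookup_map f.zero lookup_sum lookup_single when_def sum.delta' in_keys_iff)
  qed
  then show ?thesis by (simp add: eval_mpoly_def single_eq_Const_mult)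
qed

lemma ring_morphism_map:
  fixes f :: "'a::comm_ring_1 \<Rightarrow> 'b::comm_ring_1"
  assumes "ring_morphism f"
  shows "ring_morphism (Poly_Mapping.map f :: ('i, 'a) mpoly \<Rightarrow> ('i, 'b) mpoly)"
  unfolding map_eq_eval_mpoly[OF assms, abs_def]
  by (intro ring_morphism_eval_mpoly ring_morphism_comp[OF ring_morphism_Const assms])

section \<open>Total degree and its additivity\<close>

definition monomial_degree :: "('i \<Rightarrow>\<^sub>0 nat) \<Rightarrow> nat"
  where "monomial_degree m = (\<Sum>i\<in>Poly_Mapping.keys m. Poly_Mapping.lookup m i)"

text \<open>The inserted 0 gives the zero polynomial degree 0.\<close>

definition total_degree :: "('i, 'a::zero) mpoly \<Rightarrow> nat"
  where "total_degree p = Max (insert 0 (monomial_degree ` Poly_Mapping.keys p))"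

lemma monomial_degree_le: "m \<in> Poly_Mapping.keys p \<Longrightarrow> monomial_degree m \<le> total_degree p"
  unfolding total_degree_def by (intro Max_ge) auto

lemma total_degree_attained:
  assumes "p \<noteq> 0"
  obtains m where "m \<in> Poly_Mapping.keys p" "monomial_degree m = total_degree p"
proof -
  have "Poly_Mapping.keys p \<noteq> {}" using assms by simp
  then have "Max (insert 0 (monomial_degree ` Poly_Mapping.keys p)) \<in> monomial_degree ` Poly_Mapping.keys p"
    by (subst Max_insert) (auto simp: max_def)
  then show thesis using that unfolding total_degree_def by auto
qed

text \<open>The substitution \<open>x\<^sub>i \<mapsto> t x\<^sub>i\<close> turns the total degree into the degree in \<open>t\<close>. Its values lie in
  the polynomials over \<open>nat\<close>-indexed variables because only for linearly ordered index types
  does the library know that polynomials form an integral domain.\<close>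

definition grade :: "('i::countable, 'a::field) mpoly \<Rightarrow> (nat, 'a) mpoly poly"
  where "grade = eval_mpoly (\<lambda>c. [:Const c:]) (\<lambda>i. monom (Var (to_nat i)) 1)"

definition index_monomial :: "('i::countable \<Rightarrow>\<^sub>0 nat) \<Rightarrow> (nat \<Rightarrow>\<^sub>0 nat)"
  where "index_monomial m =
    (\<Sum>i\<in>Poly_Mapping.keys m. Poly_Mapping.single (to_nat i) (Poly_Mapping.lookup m i))"

lemma ring_morphism_grade: "ring_morphism grade"
  unfolding grade_def
  by (intro ring_morphism_eval_mpoly ring_morphism_comp[OF ring_morphism_const_poly] ring_morphism_Const)

lemma lookup_index_monomial: "Poly_Mapping.lookup (index_monomial m) (to_nat i) = Poly_Mapping.lookup m i"
  by (simp add: index_monomial_def lookup_sum lookup_single when_def inj_eq[OF inj_to_nat]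
      sum.delta' in_keys_iff)

lemma index_monomial_eq_iff: "index_monomial m = index_monomial n \<longleftrightarrow> m = n"
  by (metis lookup_index_monomial poly_mapping_eqI)

lemma grade_expand:
  fixes p :: "('i::countable, 'a::field) mpoly"
  shows "grade p = (\<Sum>m\<in>Poly_Mapping.keys p.
    monom (Poly_Mapping.single (index_monomial m) (Poly_Mapping.lookup p m)) (monomial_degree m))"
proof -
  have single: "monomial_value (\<lambda>i. monom (Var (to_nat i) :: (nat, 'a) mpoly) 1) m =
    monom (Poly_Mapping.single (index_monomial m) 1) (monomial_degree m)" for m :: "'i \<Rightarrow>\<^sub>0 nat"
  proof -
    have "(\<Prod>i\<in>A. monom (Var (to_nat i) :: (nat, 'a) mpoly) 1 ^ f i) =
      monom (Poly_Mapping.single (\<Sum>i\<in>A. Poly_Mapping.single (to_nat i) (f i)) 1) (sum f A)"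
      for A :: "'i set" and f
    proof (induction A rule: infinite_finite_induct)
      case (insert i A)
      have "(Var (to_nat i) :: (nat, 'a) mpoly) ^ f i = Poly_Mapping.single (Poly_Mapping.single (to_nat i) (f i)) 1"
        using monomial_value_Var[of "Poly_Mapping.single (to_nat i) (f i)"] by simp
      with insert show ?case by (simp add: monom_power mult_monom mult_single)
    qed (simp_all add: monom_0 one_pCons)
    then show ?thesis
      by (simp add: monomial_value_def index_monomial_def monomial_degree_def)
  qed
  show ?thesis
    unfolding grade_def eval_mpoly_def single
    by (simp add: Const_def smult_monom mult_single)
qed

text \<open>Distinct monomials of \<open>p\<close> stay distinct under \<open>to_nat\<close>, so
  \<open>grade\<close> loses no coefficient; its injectivity and the degree formula come from
  this.\<close>

lemma lookup_coeff_grade: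
  "Poly_Mapping.lookup (coeff (grade p) (monomial_degree m)) (index_monomial m) = Poly_Mapping.lookup p m"
proof -
  have "Poly_Mapping.lookup (coeff (grade p) (monomial_degree m)) (index_monomial m) =
    (\<Sum>n\<in>Poly_Mapping.keys p. if n = m then Poly_Mapping.lookup p n else 0)"
    unfolding grade_expand coeff_sum lookup_sum
    by (intro sum.cong) (auto simp: coeff_monom lookup_single index_monomial_eq_iff)
  then show ?thesis by (simp add: sum.delta' in_keys_iff)
qed

lemma grade_eq_0_iff [simp]: "grade p = 0 \<longleftrightarrow> p = 0"
proof
  assume "grade p = 0"
  then show "p = 0" using lookup_coeff_grade[of p] by (intro poly_mapping_eqI) simp
qed (simp add: ring_morphism.zero[OF ring_morphism_grade])

lemma degree_grade: "degree (grade p) = total_degree p"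
proof (cases "p = 0")
  case True
  then show ?thesis by (simp add: total_degree_def ring_morphism.zero[OF ring_morphism_grade])
next
  case False
  show ?thesis
  proof (rule antisym)
    show "degree (grade p) \<le> total_degree p"
      unfolding grade_expand by (intro degree_sum_le)
        (auto intro: order.trans[OF degree_monom_le] monomial_degree_le)
    obtain m where m: "m \<in> Poly_Mapping.keys p" "monomial_degree m = total_degree p"
      using total_degree_attained[OF False] .
    then have "coeff (grade p) (total_degree p) \<noteq> 0"
      using lookup_coeff_grade[of p m] by (auto simp: in_keys_iff)
    then show "total_degree p \<le> degree (grade p)" by (rule le_degree)
  qed
qed

text \<open>Pulled back along the injective homomorphism \<open>grade\<close> from an integral
  domain.\<close>

lemma mpoly_mult_eq_0_iff: "p * q = 0 \<longleftrightarrow> p = 0 \<or> q = 0"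
  for p q :: "('i::countable, 'a::field) mpoly"
  using ring_morphism.mult[OF ring_morphism_grade, of p q] grade_eq_0_iff by (metis mult_eq_0_iff)

lemma mpoly_mult_left_cancel: "p \<noteq> 0 \<Longrightarrow> p * q = p * r \<longleftrightarrow> q = r"
  for p q r :: "('i::countable, 'a::field) mpoly"
  using mpoly_mult_eq_0_iff[of p "q - r"] by (auto simp: right_diff_distrib)

lemma total_degree_mult: "p \<noteq> 0 \<Longrightarrow> q \<noteq> 0 \<Longrightarrow> total_degree (p * q) = total_degree p + total_degree q"
  for p q :: "('i::countable, 'a::field) mpoly"
  by (simp add: degree_grade[symmetric] ring_morphism.mult[OF ring_morphism_grade] degree_mult_eq)

lemma total_degree_0E:
  assumes "total_degree p = 0"
  obtains c where "p = Const c"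
proof -
  have "Poly_Mapping.lookup p m = 0" if "m \<noteq> 0" for m
  proof (rule ccontr)
    assume "Poly_Mapping.lookup p m \<noteq> 0"
    then have "monomial_degree m = 0"
      using monomial_degree_le[of m p] assms by (simp add: in_keys_iff)
    then have "Poly_Mapping.lookup m i = 0" for i
      by (cases "i \<in> Poly_Mapping.keys m") (simp_all add: monomial_degree_def in_keys_iff)
    then have "m = 0" by (intro poly_mapping_eqI) simp
    with that show False by blast
  qed
  then have "p = Const (Poly_Mapping.lookup p 0)"
    by (intro poly_mapping_eqI) (auto simp: Const_def lookup_single when_def)
  then show thesis using that by blast
qed

lemma total_degree_Const [simp]: "total_degree (Const c) = 0"
  by (simp add: total_degree_def Const_def monomial_degree_def)

lemma Const_eq_0_iff [simp]: "Const c = 0 \<longleftrightarrow> c = 0"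
  unfolding Const_def by (metis lookup_single_eq lookup_zero single_zero)

text \<open>Degrees add in products, so both factors of 1 are constant; conversely nonzero constants
  are inverted in the coefficient field.\<close>

lemma mpoly_is_unit_iff: "p dvd 1 \<longleftrightarrow> p \<noteq> 0 \<and> total_degree p = 0"
  for p :: "('i::countable, 'a::field) mpoly"
proof
  assume "p dvd 1"
  then obtain q where q: "1 = p * q" by blast
  then have "p \<noteq> 0" "q \<noteq> 0" by auto
  moreover have "total_degree (1 :: ('i, 'a) mpoly) = 0"
    by (simp add: total_degree_def monomial_degree_def)
  ultimately show "p \<noteq> 0 \<and> total_degree p = 0" using q total_degree_mult[of p q] by simp
next
  assume p: "p \<noteq> 0 \<and> total_degree p = 0"
  then obtain c where c: "p = Const c" using total_degree_0E by blast
  then have "1 = p * Const (inverse c)"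
    using p by (simp add: ring_morphism.mult[OF ring_morphism_Const, symmetric]
        ring_morphism.one[OF ring_morphism_Const])
  then show "p dvd 1" by (rule dvdI)
qed

text \<open>Induction on the total degree: in a proper factorization the second factor is not a
  unit, hence of positive degree, and the first has smaller degree.\<close>

lemma irreducible_factor_exists:
  fixes p :: "('i::countable, 'a::field) mpoly"
  assumes "p \<noteq> 0" "\<not> p dvd 1"
  shows "\<exists>f. Factorial_Ring.irreducible f \<and> f dvd p"
  using assms
proof (induction "total_degree p" arbitrary: p rule: less_induct)
  case less
  show ?case
  proof (cases "Factorial_Ring.irreducible p")
    case False
    then obtain a b where ab: "p = a * b" "\<not> a dvd 1" "\<not> b dvd 1"
      using less.prems unfolding Factorial_Ring.irreducible_def by blast
    then have nz: "a \<noteq> 0" "b \<noteq> 0" using less.prems by auto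
    then have "total_degree a < total_degree p"
      using ab total_degree_mult[OF nz] mpoly_is_unit_iff[of b] by simp
    then show ?thesis using less.hyps[of a] ab nz by (metis dvd_mult2)
  qed auto
qed

section \<open>Unique factorization of multivariate polynomials\<close>

text \<open>Mutually inverse multiplicative maps between \<open>S\<close> and \<open>R\<close>
  preserve relative divisibility and units, hence irreducibles and primes. This serves to isolate
  one variable of a polynomial ring.\<close>

lemma subring_iso_transfer:
  assumes hom: "\<And>a b. h (a * b) = h a * h b" "h 1 = 1" "\<And>a b. g (a * b) = g a * g b" "g 1 = 1"
    and mem: "\<And>a. a \<in> S \<Longrightarrow> h a \<in> R" "\<And>b. b \<in> R \<Longrightarrow> g b \<in> S"
    and inv: "\<And>a. a \<in> S \<Longrightarrow> g (h a) = a" "\<And>b. b \<in> R \<Longrightarrow> h (g b) = b"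
    and sub: "idom_subring S" "idom_subring R"
    and zero: "h 0 = 0"
  shows "irreducible_in S p \<Longrightarrow> irreducible_in R (h p)"
    and "p \<in> S \<Longrightarrow> prime_in R (h p) \<Longrightarrow> prime_in S p"
proof -
  have S1: "1 \<in> S" "0 \<in> S" and R1: "1 \<in> R"
    using sub idom_subring.one_mem idom_subring.zero_mem by blast+
  have dvd: "dvd_in R (h a) (h b) \<longleftrightarrow> dvd_in S a b" if ab: "a \<in> S" "b \<in> S" for a b
  proof
    assume "dvd_in R (h a) (h b)"
    then obtain c where "c \<in> R" "h b = h a * c" unfolding dvd_in_def by blast
    then have "g (h b) = g (h a) * g c" "g c \<in> S" using hom mem by simp_all
    then show "dvd_in S a b" using inv ab unfolding dvd_in_def by auto
  next
    assume "dvd_in S a b"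
    then show "dvd_in R (h a) (h b)" using hom(1) mem(1) unfolding dvd_in_def by blast
  qed
  have unit: "unit_in R (h a) \<longleftrightarrow> unit_in S a" if "a \<in> S" for a
    using dvd[OF that S1(1)] that mem(1) hom(2) unfolding unit_in_def by simp
  have h0: "h a = 0 \<longleftrightarrow> a = 0" if "a \<in> S" for a
    using inv(1)[OF that] inv(1)[OF S1(2)] zero by metis
  {
    assume p: "irreducible_in S p"
    note pD = idom_subring.irreducible_inD[OF sub(1) p]
    show "irreducible_in R (h p)"
      unfolding irreducible_in_def
    proof (intro conjI ballI impI)
      show "h p \<in> R" "h p \<noteq> 0" "\<not> unit_in R (h p)"
        using pD(1-3) mem h0 unit by auto
      fix a b assume ab: "a \<in> R" "b \<in> R" "h p = a * b"
      then have "p = g a * g b" using inv(1)[OF pD(1)] hom(3) by metis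
      then have "unit_in S (g a) \<or> unit_in S (g b)" using pD(4) mem ab by blast
      then show "unit_in R a \<or> unit_in R b"
        using unit[OF mem(2)[OF ab(1)]] unit[OF mem(2)[OF ab(2)]] inv(2) ab by simp
    qed
  }
  {
    assume pS: "p \<in> S" and p: "prime_in R (h p)"
    note pD = idom_subring.prime_inD[OF sub(2) p]
    show "prime_in S p"
      unfolding prime_in_def
    proof (intro conjI ballI impI)
      show "p \<in> S" "p \<noteq> 0" "\<not> unit_in S p" using pS pD(2,3) h0 unit by auto
      fix a b assume ab: "a \<in> S" "b \<in> S" "dvd_in S p (a * b)"
      then have "dvd_in R (h p) (h a * h b)"
        using dvd[OF pS, of "a * b"] idom_subring.mult_mem[OF sub(1)] hom(1) by simp
      then show "dvd_in S p a \<or> dvd_in S p b"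
        using pD(4)[of "h a" "h b"] mem ab dvd pS by blast
    qed
  }
qed

lemma (in idom_subring) unit_in_mult: "unit_in S u \<Longrightarrow> unit_in S v \<Longrightarrow> unit_in S (u * v)"
proof -
  assume "unit_in S u" "unit_in S v"
  then obtain u' v' where "u \<in> S" "u' \<in> S" "u * u' = 1" "v \<in> S" "v' \<in> S" "v * v' = 1"
    by (elim unit_inE)
  then have "(u * v) * (u' * v') = 1" by (metis mult.assoc mult.commute mult_1)
  then show "unit_in S (u * v)"
    using \<open>u \<in> S\<close> \<open>u' \<in> S\<close> \<open>v \<in> S\<close> \<open>v' \<in> S\<close> by (intro unit_inI[of "u * v" "u' * v'"] mult_mem)
qed

section \<open>Polynomials in a prescribed set of variables\<close>

definition mpolys_in :: "'i set \<Rightarrow> ('i, 'a::zero) mpoly set"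
  where "mpolys_in V = {p. \<forall>m\<in>Poly_Mapping.keys p. Poly_Mapping.keys m \<subseteq> V}"

lemma Const_mem_mpolys_in [simp]: "Const c \<in> mpolys_in V"
  by (auto simp: mpolys_in_def Const_def split: if_splits)

lemma Var_mem_mpolys_in [simp]: "Var i \<in> mpolys_in V \<longleftrightarrow> i \<in> V"
  by (auto simp: mpolys_in_def Var_def)

lemma mpolys_in_mono: "V \<subseteq> W \<Longrightarrow> mpolys_in V \<subseteq> mpolys_in W"
  unfolding mpolys_in_def by blast

lemma idom_subring_mpolys_in: "idom_subring (mpolys_in V :: (nat, 'a::field) mpoly set)"
proof
  fix a b :: "(nat, 'a) mpoly"
  assume ab: "a \<in> mpolys_in V" "b \<in> mpolys_in V"
  then show "a - b \<in> mpolys_in V"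
    unfolding mpolys_in_def using Poly_Mapping.keys_diff[of a b] by blast
  show "a * b \<in> mpolys_in V"
    unfolding mpolys_in_def
  proof (intro CollectI ballI)
    fix m assume "m \<in> Poly_Mapping.keys (a * b)"
    then obtain k l where "m = k + l" "k \<in> Poly_Mapping.keys a" "l \<in> Poly_Mapping.keys b"
      using keys_mult[of a b] by blast
    then show "Poly_Mapping.keys m \<subseteq> V"
      using ab Poly_Mapping.keys_add[of k l] unfolding mpolys_in_def by blast
  qed
qed (simp add: mpolys_in_def)

lemma (in idom_subring) power_mem: "a \<in> S \<Longrightarrow> a ^ n \<in> S"
  by (induction n) (auto simp: one_mem mult_mem)

lemma (in idom_subring) prod_mem: "(\<And>i. i \<in> I \<Longrightarrow> f i \<in> S) \<Longrightarrow> prod f I \<in> S"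
  by (induction I rule: infinite_finite_induct) (auto simp: one_mem mult_mem)

lemma (in idom_subring) eval_mpoly_mem:
  assumes "p \<in> mpolys_in V" "\<And>c. \<phi> c \<in> S" "\<And>i. i \<in> V \<Longrightarrow> x i \<in> S"
  shows "eval_mpoly \<phi> x p \<in> S"
  unfolding eval_mpoly_def monomial_value_def
  using assms by (intro sum_mem mult_mem prod_mem power_mem) (auto simp: mpolys_in_def)

text \<open>The passage from K[V, x_k] to K[V][x_k] for \<open>k\<close> outside \<open>V\<close>;
  its inverse is evaluation at \<open>Var k\<close>.\<close>

definition separate_var :: "nat \<Rightarrow> (nat, 'a::field) mpoly \<Rightarrow> (nat, 'a) mpoly poly"
  where "separate_var k = eval_mpoly (\<lambda>c. [:Const c:]) (\<lambda>i. if i = k then monom 1 1 else [:Var i:])"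

lemma ring_morphism_separate_var: "ring_morphism (separate_var k)"
  unfolding separate_var_def
  by (intro ring_morphism_eval_mpoly ring_morphism_comp[OF ring_morphism_const_poly] ring_morphism_Const)

lemma separate_var_mem:
  assumes "p \<in> mpolys_in (insert k V)"
  shows "separate_var k p \<in> polys_over (mpolys_in V)"
proof -
  interpret S: idom_subring "mpolys_in V :: (nat, 'a) mpoly set"
    by (rule idom_subring_mpolys_in)
  show ?thesis
    unfolding separate_var_def
    by (rule idom_subring.eval_mpoly_mem[OF S.idom_subring_polys_over assms])
      (auto simp: S.one_mem intro!: S.monom_mem_polys_over)
qed

lemma poly_separate_var: "poly (separate_var k p) (Var k) = p"
proof -
  have "poly (separate_var k p) (Var k) = eval_mpoly Const Var p"
    unfolding separate_var_def ring_morphism.eval_mpoly[OF ring_morphism_poly]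
    by (simp add: poly_monom if_distrib[of "\<lambda>q. poly q _"] cong: if_cong)
      (rule eval_mpoly_cong; simp)
  then show ?thesis by (simp add: eval_mpoly_Const_Var)
qed

lemma separate_var_const:
  assumes "p \<in> mpolys_in V" "k \<notin> V"
  shows "separate_var k p = [:p:]"
proof -
  have "separate_var k p = eval_mpoly (\<lambda>c. [:Const c:]) (\<lambda>i. [:Var i:]) p"
    unfolding separate_var_def using assms by (intro eval_mpoly_cong) (auto simp: mpolys_in_def)
  also have "\<dots> = [:p:]"
    using ring_morphism.eval_mpoly[OF ring_morphism_const_poly, of Const Var p]
    by (simp add: eval_mpoly_Const_Var)
  finally show ?thesis .
qed

lemma separate_var_poly:
  assumes "q \<in> polys_over (mpolys_in V)" "k \<notin> V"
  shows "separate_var k (poly q (Var k)) = q"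
proof -
  interpret h: ring_morphism "separate_var k :: (nat, 'a) mpoly \<Rightarrow> _"
    by (rule ring_morphism_separate_var)
  have var: "separate_var k (Var k) = (monom 1 1 :: (nat, 'a) mpoly poly)"
    unfolding separate_var_def
    by (subst eval_mpoly_Var)
      (auto intro: ring_morphism_comp[OF ring_morphism_const_poly] ring_morphism_Const)
  have const: "separate_var k (coeff q i) = [:coeff q i:]" for i
    using assms by (intro separate_var_const[of _ V]) (auto simp: polys_over_def)
  have "separate_var k (poly q (Var k)) = (\<Sum>i\<le>degree q. [:coeff q i:] * monom 1 1 ^ i)"
    unfolding poly_altdef h.sum h.mult h.power var const ..
  also have "\<dots> = (\<Sum>i\<le>degree q. monom (coeff q i) i)"
    by (intro sum.cong) (auto simp: monom_power smult_monom)
  also have "\<dots> = q" by (rule poly_as_sum_of_monoms)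
  finally show ?thesis .
qed

lemma poly_Var_mem:
  assumes "q \<in> polys_over (mpolys_in V)"
  shows "poly q (Var k) \<in> (mpolys_in (insert k V) :: (nat, 'a::field) mpoly set)"
proof -
  interpret S: idom_subring "mpolys_in (insert k V) :: (nat, 'a) mpoly set"
    by (rule idom_subring_mpolys_in)
  show ?thesis
    unfolding poly_altdef using assms mpolys_in_mono[of V "insert k V"]
    by (intro S.sum_mem S.mult_mem S.power_mem) (auto simp: polys_over_def)
qed

lemma unit_in_Const: "c \<noteq> 0 \<Longrightarrow> unit_in (mpolys_in V) (Const c :: (nat, 'a::field) mpoly)"
  by (rule idom_subring.unit_inI[OF idom_subring_mpolys_in, of _ _ "Const (inverse c)"])
    (simp_all add: ring_morphism.mult[OF ring_morphism_Const, symmetric]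
      ring_morphism.one[OF ring_morphism_Const])

text \<open>Factorization into irreducibles exists by induction on the total degree: a nonzero
  nonunit has positive degree, so both factors of a proper factorization have smaller degree. Only
  the primality of irreducibles remains to be supplied.\<close>

lemma factorial_in_mpolys_in_if:
  assumes prime: "\<And>p :: (nat, 'a::field) mpoly. irreducible_in (mpolys_in V) p \<Longrightarrow> prime_in (mpolys_in V) p"
  shows "factorial_in (mpolys_in V :: (nat, 'a) mpoly set)"
proof -
  interpret S: idom_subring "mpolys_in V :: (nat, 'a) mpoly set"
    by (rule idom_subring_mpolys_in)
  have "\<exists>u ps. unit_in (mpolys_in V) u \<and> (\<forall>p\<in>set ps. prime_in (mpolys_in V) p) \<and> a = u * prod_list ps"
    if "a \<in> mpolys_in V" "a \<noteq> 0" for a :: "(nat, 'a) mpoly"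
    using that
  proof (induction "total_degree a" arbitrary: a rule: less_induct)
    case less
    consider "unit_in (mpolys_in V) a" | "irreducible_in (mpolys_in V) a" |
      b c where "b \<in> mpolys_in V" "c \<in> mpolys_in V" "a = b * c"
        "\<not> unit_in (mpolys_in V) b" "\<not> unit_in (mpolys_in V) c"
      using less.prems unfolding irreducible_in_def by blast
    then show ?case
    proof cases
      case 1
      then show ?thesis by (intro exI[of _ a] exI[of _ "[]"]) auto
    next
      case 2
      then show ?thesis
        using prime unit_in_Const[of 1 V]
        by (intro exI[of _ 1] exI[of _ "[a]"]) (auto simp: Const_def)
    next
      case 3
      have nz: "b \<noteq> 0" "c \<noteq> 0" using 3 less.prems by auto
      have pos: "total_degree p > 0" if "\<not> unit_in (mpolys_in V) p" "p \<noteq> 0" for p :: "(nat, 'a) mpoly"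
      proof (rule ccontr)
        assume "\<not> total_degree p > 0"
        then obtain d where "p = Const d" using total_degree_0E by blast
        then show False using that unit_in_Const[of d V] by auto
      qed
      have "total_degree b < total_degree a" "total_degree c < total_degree a"
        using pos[OF 3(4) nz(1)] pos[OF 3(5) nz(2)] total_degree_mult[OF nz] 3(3) by simp_all
      then obtain u ps v qs where
        "unit_in (mpolys_in V) u" "\<forall>p\<in>set ps. prime_in (mpolys_in V) p" "b = u * prod_list ps"
        "unit_in (mpolys_in V) v" "\<forall>p\<in>set qs. prime_in (mpolys_in V) p" "c = v * prod_list qs"
        using less.hyps[of b] less.hyps[of c] 3 nz by metis
      then show ?thesis
        using S.unit_in_mult 3(3)
        by (intro exI[of _ "u * v"] exI[of _ "ps @ qs"]) (auto simp: mult_ac)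
    qed
  qed
  then show ?thesis unfolding factorial_in_def by blast
qed

text \<open>Adding a variable \<open>k\<close> means passing to polynomials over
  \<open>mpolys_in V\<close>: an irreducible is carried there by \<open>separate_var k\<close>, is
  prime by the Gauss argument, and is carried back.\<close>

theorem factorial_in_mpolys_in:
  assumes "finite V"
  shows "factorial_in (mpolys_in V :: (nat, 'a::field) mpoly set)"
  using assms
proof (induction V)
  case empty
  have "p = Const (Poly_Mapping.lookup p 0)" if "p \<in> mpolys_in {}" for p :: "(nat, 'a) mpoly"
    using that by (intro poly_mapping_eqI)
      (auto simp: mpolys_in_def Const_def lookup_single when_def in_keys_iff)
  then have "unit_in (mpolys_in {}) p" if "p \<in> mpolys_in {}" "p \<noteq> 0" for p :: "(nat, 'a) mpoly"
    using that unit_in_Const by (metis Const_eq_0_iff)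
  \<comment> \<open>Without variables every nonzero polynomial is a unit, so there are no
    irreducibles to check.\<close>
  then show ?case
    by (intro factorial_in_mpolys_in_if) (auto simp: irreducible_in_def)
next
  case (insert k V)
  let ?S = "mpolys_in (insert k V) :: (nat, 'a) mpoly set"
  let ?R = "polys_over (mpolys_in V) :: (nat, 'a) mpoly poly set"
  interpret h: ring_morphism "separate_var k :: (nat, 'a) mpoly \<Rightarrow> _"
    by (rule ring_morphism_separate_var)
  have R: "idom_subring ?R"
    by (rule idom_subring.idom_subring_polys_over[OF idom_subring_mpolys_in])
  note transfer = subring_iso_transfer[of "separate_var k" "\<lambda>q. poly q (Var k)" ?S ?R,
      OF h.mult h.one _ _ separate_var_mem poly_Var_mem poly_separate_var separate_var_poly[OF _ insert(2)]
        idom_subring_mpolys_in R h.zero, simplified]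
  show ?case
  proof (rule factorial_in_mpolys_in_if)
    fix p :: "(nat, 'a) mpoly" assume p: "irreducible_in ?S p"
    then have "prime_in ?R (separate_var k p)"
      using transfer(1) idom_subring.irreducible_in_polys_over_imp_prime_in[OF idom_subring_mpolys_in insert.IH]
      by blast
    then show "prime_in ?S p"
      using transfer(2) p unfolding irreducible_in_def by blast
  qed
qed

text \<open>Renaming the variables to natural numbers, \<open>h\<close> is an isomorphism onto
  \<open>mpolys_in V\<close> with \<open>V\<close> finite, where irreducibles are already
  prime.\<close>

theorem irreducible_imp_prime_elem_mpoly:
  fixes p :: "('d::finite, 'a::field) mpoly"
  assumes "Factorial_Ring.irreducible p"
  shows "prime_elem p"
proof -
  define V where "V = range (to_nat :: 'd \<Rightarrow> nat)"
  define h :: "('d, 'a) mpoly \<Rightarrow> (nat, 'a) mpoly" where "h = eval_mpoly Const (\<lambda>i. Var (to_nat i))"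
  define g :: "(nat, 'a) mpoly \<Rightarrow> ('d, 'a) mpoly" where "g = eval_mpoly Const (\<lambda>i. Var (from_nat i))"
  interpret S: idom_subring "mpolys_in V :: (nat, 'a) mpoly set"
    by (rule idom_subring_mpolys_in)
  interpret h: ring_morphism h
    unfolding h_def by (intro ring_morphism_eval_mpoly ring_morphism_Const)
  interpret g: ring_morphism g
    unfolding g_def by (intro ring_morphism_eval_mpoly ring_morphism_Const)
  have gh: "g (h q) = q" for q
    unfolding h_def g.eval_mpoly
    unfolding g_def by (simp add: eval_mpoly_Const eval_mpoly_Var ring_morphism_Const eval_mpoly_Const_Var)
  \<comment> \<open>\<open>to_nat (from_nat i) = i\<close> is available for \<open>i\<close> in
    \<open>V\<close>, hence the restriction to \<open>mpolys_in V\<close>.\<close>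
  have hg: "h (g q) = q" if "q \<in> mpolys_in V" for q
  proof -
    have "h (g q) = eval_mpoly Const (\<lambda>i. Var (to_nat (from_nat i :: 'd))) q"
      unfolding g_def h.eval_mpoly
      unfolding h_def by (simp add: eval_mpoly_Const eval_mpoly_Var ring_morphism_Const)
    also have "\<dots> = eval_mpoly Const Var q"
    proof (rule eval_mpoly_cong)
      fix m i assume "m \<in> Poly_Mapping.keys q" "i \<in> Poly_Mapping.keys m"
      then have "i \<in> range (to_nat :: 'd \<Rightarrow> nat)"
        using that unfolding mpolys_in_def V_def by blast
      then show "Var (to_nat (from_nat i :: 'd)) = (Var i :: (nat, 'a) mpoly)" by auto
    qed
    finally show ?thesis by (simp add: eval_mpoly_Const_Var)
  qed
  have mem: "h q \<in> mpolys_in V" for q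
    unfolding h_def by (rule S.eval_mpoly_mem[of _ UNIV]) (auto simp: mpolys_in_def V_def Const_def Var_def)
  have dvd: "dvd_in (mpolys_in V) (h a) (h b) \<longleftrightarrow> a dvd b" for a b
  proof
    assume "dvd_in (mpolys_in V) (h a) (h b)"
    then obtain c where "h b = h a * c" unfolding dvd_in_def by blast
    then have "b = a * g c" using gh g.mult by metis
    then show "a dvd b" by simp
  next
    assume "a dvd b"
    then show "dvd_in (mpolys_in V) (h a) (h b)"
      unfolding dvd_in_def using h.mult mem by blast
  qed
  have unit: "unit_in (mpolys_in V) (h a) \<longleftrightarrow> a dvd 1" for a
    using dvd[of a 1] mem unfolding unit_in_def h.one by simp
  have h0: "h a = 0 \<longleftrightarrow> a = 0" for a
    using gh[of a] g.zero h.zero by metis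
  have p: "p \<noteq> 0" "\<not> p dvd 1" and irr: "\<And>a b. p = a * b \<Longrightarrow> a dvd 1 \<or> b dvd 1"
    using assms unfolding Factorial_Ring.irreducible_def by blast+
  have "irreducible_in (mpolys_in V) (h p)"
    unfolding irreducible_in_def unit h0
  proof (intro conjI ballI impI)
    fix a b assume ab: "a \<in> mpolys_in V" "b \<in> mpolys_in V" "h p = a * b"
    then have "p = g a * g b" using gh g.mult by metis
    then have "g a dvd 1 \<or> g b dvd 1" by (rule irr)
    then show "unit_in (mpolys_in V) a \<or> unit_in (mpolys_in V) b"
      using unit[of "g a"] unit[of "g b"] hg ab by simp
  qed (use p mem in auto)
  then have "prime_in (mpolys_in V) (h p)"
    by (intro S.irreducible_in_imp_prime_in factorial_in_mpolys_in) (auto simp: V_def)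
  from S.prime_inD(4)[OF this mem mem] show ?thesis
    using p by (intro prime_elemI) (auto simp: h.mult[symmetric] dvd)
qed

section \<open>The Frobenius automorphism of the algebraic closure\<close>

text \<open>Multiplication by a nonzero \<open>x\<close> permutes the nonzero elements; comparing
  their products gives \<open>x ^ (CARD('a) - 1) = 1\<close>.\<close>

lemma finite_field_power_card:
  fixes x :: "'a::{field, finite}"
  shows "x ^ CARD('a) = x"
proof (cases "x = 0")
  case False
  let ?U = "UNIV - {0 :: 'a}"
  have "(\<Prod>y\<in>?U. x * y) = \<Prod>?U"
    using False by (intro prod.reindex_bij_witness[of _ "\<lambda>y. y / x" "\<lambda>y. x * y"]) auto
  then have "x ^ card ?U * \<Prod>?U = \<Prod>?U"
    unfolding prod.distrib prod_constant .
  moreover have "\<Prod>?U \<noteq> 0" by (subst prod_zero_iff) auto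
  ultimately have "x ^ card ?U = 1" by (metis mult_cancel_right1)
  moreover have "CARD('a) = Suc (card ?U)"
    by (rule card.remove) auto
  ultimately show ?thesis by (simp only: power_Suc mult_1_right)
qed simp

definition frob :: "'a::{field, finite} alg_closure \<Rightarrow> 'a alg_closure"
  where "frob x = x ^ CARD('a)"

lemma card_gt_1: "CARD('a::{field, finite}) > 1"
  using card_mono[of "UNIV :: 'a set" "{0, 1}"] by simp

lemma card_range_to_ac: "card (range (to_ac :: 'a::{field, finite} \<Rightarrow> _)) = CARD('a)"
  by (rule card_image[OF inj_to_ac])

lemma frob_to_ac [simp]: "frob (to_ac a) = to_ac a"
  unfolding frob_def by (simp only: to_ac_power[symmetric] finite_field_power_card)

text \<open>The leading terms cancel, so the difference can be identified from its values at
  \<open>n\<close> points. Positivity of \<open>n\<close> covers a zero difference, whose degree is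
  0.\<close>

lemma degree_monic_diff_less:
  fixes p q :: "'a::comm_ring_1 poly"
  assumes "degree p = n" "degree q = n" "lead_coeff p = 1" "lead_coeff q = 1" "n > 0"
  shows "degree (p - q) < n"
proof -
  have "degree (p - q) \<le> n" using assms by (intro degree_diff_le) auto
  moreover have "coeff (p - q) n = 0" using assms by simp
  ultimately show ?thesis using assms(5) by (metis degree_0 le_neq_implies_less leading_coeff_0_iff)
qed

text \<open>With q = \<open>CARD('a)\<close>, both X^q and the product \<open>R\<close> of all X - a
  are monic of degree q. Their difference has degree below q and agrees with X at the q points of
  the base field, so it equals X.\<close>

lemma frob_minus_eq_prod:
  fixes y :: "'a::{field, finite} alg_closure"
  shows "frob y - y = (\<Prod>a::'a\<in>UNIV. y - to_ac a)"
proof -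
  define R where "R = (\<Prod>a::'a\<in>UNIV. [:- to_ac a, 1:])"
  have R: "degree R = CARD('a)" "lead_coeff R = 1"
    unfolding R_def lead_coeff_prod by (simp_all add: degree_prod_sum_eq)
  have "monom 1 (CARD('a)) - R = [:0, 1:]"
  proof (rule poly_eqI_degree[of "range to_ac"])
    fix x :: "'a alg_closure" assume "x \<in> range to_ac"
    then obtain a :: 'a where a: "x = to_ac a" by blast
    then have "poly R x = 0" unfolding R_def poly_prod by (intro prod_zero) auto
    moreover have "x ^ CARD('a) = x" using frob_to_ac[of a] a unfolding frob_def by simp
    ultimately show "poly (monom 1 (CARD('a)) - R) x = poly [:0, 1:] x"
      by (simp add: poly_monom)
  next
    show "card (range (to_ac :: 'a \<Rightarrow> _)) > degree (monom 1 (CARD('a)) - R)"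
      unfolding card_range_to_ac using R card_gt_1[where 'a = 'a]
      by (intro degree_monic_diff_less) (auto simp: Polynomial.degree_monom_eq)
  qed (use card_gt_1[where 'a = 'a] card_range_to_ac[where 'a = 'a] in auto)
  then have "poly (monom 1 (CARD('a)) - R) y = y" by simp
  then show ?thesis
    by (simp add: poly_monom R_def poly_prod frob_def algebra_simps)
qed

text \<open>The product formula is invariant under translation by \<open>'a\<close>, so \<open>frob (z + y) - frob z - frob y\<close>
  is a polynomial in \<open>z\<close> of degree below \<open>CARD('a)\<close> that vanishes on \<open>'a\<close>.\<close>

lemma frob_add: "frob (z + y) = frob z + frob y"
  for z y :: "'a::{field, finite} alg_closure"
proof -
  have shift: "frob (to_ac a + y) = to_ac a + frob y" for a :: 'a
  proof -
    have "(\<Prod>b\<in>UNIV. to_ac a + y - to_ac b) = (\<Prod>b::'a\<in>UNIV. y - to_ac b)"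
      by (rule prod.reindex_bij_witness[of _ "\<lambda>b. b + a" "\<lambda>b. b - a"]) (auto simp: algebra_simps)
    then show ?thesis
      using frob_minus_eq_prod[of y] frob_minus_eq_prod[of "to_ac a + y"] by (simp add: algebra_simps)
  qed
  let ?p = "[:y, 1:] ^ CARD('a) - monom 1 (CARD('a))"
  have deg: "degree ([:y, 1:] ^ CARD('a)) = CARD('a)" by (simp add: degree_power_eq)
  have lc: "coeff ([:y, 1:] ^ CARD('a)) (CARD('a)) = 1"
    using lead_coeff_power[of "[:y, 1:]" "CARD('a)"] deg by simp
  have "?p = [:frob y:]"
  proof (rule poly_eqI_degree[of "range to_ac"])
    fix x :: "'a alg_closure" assume "x \<in> range to_ac"
    then obtain a :: 'a where a: "x = to_ac a" by blast
    then have "(y + x) ^ CARD('a) = x + frob y" "x ^ CARD('a) = x"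
      using shift[of a] frob_to_ac[of a] unfolding frob_def by (simp_all add: add.commute)
    then show "poly ?p x = poly [:frob y:] x" by (simp add: poly_monom)
  next
    show "card (range (to_ac :: 'a \<Rightarrow> _)) > degree ?p"
      unfolding card_range_to_ac using card_gt_1[where 'a = 'a] deg lc
      by (intro degree_monic_diff_less) (auto simp: Polynomial.degree_monom_eq)
  qed (use card_gt_1[where 'a = 'a] card_range_to_ac[where 'a = 'a] in auto)
  then have "poly ?p z = frob y" by simp
  then show ?thesis
    by (simp add: poly_monom frob_def algebra_simps)
qed

lemma ring_morphism_frob: "ring_morphism frob"
  by unfold_locales (auto simp: frob_add, auto simp: frob_def power_mult_distrib)

lemma frob_eq_0_iff [simp]: "frob x = 0 \<longleftrightarrow> x = 0"
  using card_gt_1[where 'a = 'a] by (simp add: frob_def)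

lemma inj_frob: "inj frob"
proof (rule injI)
  fix x y :: "'a alg_closure" assume "frob x = frob y"
  then have "frob (x - y) = 0" by (simp add: ring_morphism.diff[OF ring_morphism_frob])
  then show "x = y" by simp
qed

text \<open>The fixed points are the roots of the product in
  \<open>frob_minus_eq_prod\<close>.\<close>

lemma frob_fixed_iff: "frob x = x \<longleftrightarrow> x \<in> range to_ac"
proof
  assume "frob x = x"
  then have "(\<Prod>a::'a\<in>UNIV. x - to_ac a) = 0" using frob_minus_eq_prod[of x] by simp
  then show "x \<in> range to_ac" by auto
qed auto

text \<open>All iterates of \<open>x\<close> are roots of one nonzero polynomial over the base
  field, so two of them coincide; injectivity of \<open>frob\<close> pulls the coincidence back to
  \<open>x\<close> itself.\<close>

lemma frob_periodic:
  fixes x :: "'a::{field, finite} alg_closure"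
  shows "\<exists>n>0. (frob ^^ n) x = x"
proof -
  obtain p :: "'a poly" where p: "p \<noteq> 0" "poly (map_poly to_ac p) x = 0"
    using alg_closure_algebraic by blast
  interpret frob: ring_morphism "frob :: 'a alg_closure \<Rightarrow> _" by (rule ring_morphism_frob)
  have step: "poly (map_poly to_ac p) (frob y) = frob (poly (map_poly to_ac p) y)" for y
    by (simp add: poly_altdef frob.sum frob.mult frob.power coeff_map_poly)
  have root: "poly (map_poly to_ac p) ((frob ^^ n) x) = 0" for n
    by (induction n) (auto simp: p step)
  have "map_poly to_ac p \<noteq> 0" using p(1) by (simp add: map_poly_eq_0_iff)
  then have "finite {y. poly (map_poly to_ac p) y = 0}" by (rule poly_roots_finite)
  then have "finite (range (\<lambda>n. (frob ^^ n) x))"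
    by (rule rev_finite_subset) (use root in auto)
  then have "\<not> inj (\<lambda>n. (frob ^^ n) x)" by (metis finite_imageD infinite_UNIV_nat)
  then obtain i j where ij: "i \<noteq> j" "(frob ^^ i) x = (frob ^^ j) x" unfolding inj_def by blast
  have *: "\<exists>n>0. (frob ^^ n) x = x" if "i < j" "(frob ^^ i) x = (frob ^^ j) x" for i j
  proof -
    have "(frob ^^ i) ((frob ^^ (j - i)) x) = (frob ^^ i) x"
      using that by (metis comp_apply funpow_add le_add_diff_inverse less_imp_le)
    moreover have "inj (frob ^^ i :: 'a alg_closure \<Rightarrow> _)" using inj_frob by (rule inj_fn)
    ultimately have "(frob ^^ (j - i)) x = x" by (simp add: inj_eq)
    then show ?thesis using that by (intro exI[of _ "j - i"]) auto
  qed
  show ?thesis using ij *[of i j] *[of j i] by (metis linorder_neqE_nat)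
qed

section \<open>Conjugate factors over a finite field\<close>

lemma ring_morphism_to_ac: "ring_morphism to_ac"
  by unfold_locales auto

lemma total_degree_map:
  assumes "\<And>c. f c = 0 \<longleftrightarrow> c = 0"
  shows "total_degree (Poly_Mapping.map f p) = total_degree p"
proof -
  have "Poly_Mapping.keys (Poly_Mapping.map f p) = Poly_Mapping.keys p"
    using lookup_map[of f p] assms by (simp add: set_eq_iff in_keys_iff)
  then show ?thesis by (simp add: total_degree_def)
qed

lemma map_eq_0_iff:
  assumes "\<And>c. f c = 0 \<longleftrightarrow> c = 0"
  shows "Poly_Mapping.map f p = 0 \<longleftrightarrow> p = 0"
  using lookup_map[of f p] assms by (simp add: poly_mapping_eq_iff fun_eq_iff)

lemma lookup_Const_mult: "Poly_Mapping.lookup (Const c * p) m = c * Poly_Mapping.lookup p m"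
  unfolding Const_def mult_map_scale_conv_mult[symmetric] by (simp add: lookup_map)

lemma prime_elem_dvd_prodD:
  fixes p :: "'a::comm_semiring_1"
  assumes "prime_elem p" "finite I" "p dvd prod g I"
  shows "\<exists>i\<in>I. p dvd g i"
  using assms(2,3)
proof (induction I)
  case empty
  then show ?case using assms(1) by (simp add: prime_elem_def)
next
  case (insert i I)
  then show ?case using assms(1) by (auto simp: prime_elem_def)
qed

text \<open>By primality \<open>g i\<close> does not divide the product of the others, so it divides
  the cofactor of that product in \<open>P\<close>.\<close>

lemma prod_prime_elems_dvd:
  fixes P :: "'a::comm_semiring_1"
  assumes "finite I" "\<And>i. i \<in> I \<Longrightarrow> prime_elem (g i)" "\<And>i. i \<in> I \<Longrightarrow> g i dvd P"
    "\<And>i j. i \<in> I \<Longrightarrow> j \<in> I \<Longrightarrow> i \<noteq> j \<Longrightarrow> \<not> g i dvd g j"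
  shows "prod g I dvd P"
  using assms
proof (induction I)
  case (insert i I)
  then have "prod g I dvd P" by blast
  then obtain c where c: "P = prod g I * c" by blast
  have "\<not> g i dvd prod g I"
    using prime_elem_dvd_prodD[of "g i" I g] insert by blast
  moreover have "g i dvd prod g I * c" using insert.prems(2)[of i] c by simp
  ultimately have "g i dvd c" using insert.prems(1)[of i] by (auto simp: prime_elem_def)
  then show ?case using insert.hyps c by (auto simp: dvd_def mult_ac)
qed simp

section \<open>Conjugation of coefficients\<close>

definition conj_mpoly :: "('i, 'a::{field, finite} alg_closure) mpoly \<Rightarrow> ('i, 'a alg_closure) mpoly"
  where "conj_mpoly = Poly_Mapping.map frob"

lemma ring_morphism_conj_mpoly_funpow: "ring_morphism (conj_mpoly ^^ n)"
proof (induction n)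
  case 0
  then show ?case by (simp add: ring_morphism_id id_def)
next
  case (Suc n)
  then show ?case
    using ring_morphism_comp[OF ring_morphism_map[OF ring_morphism_frob] Suc]
    by (simp add: conj_mpoly_def comp_def)
qed

lemma lookup_conj_mpoly_funpow:
  "Poly_Mapping.lookup ((conj_mpoly ^^ n) p) m = (frob ^^ n) (Poly_Mapping.lookup p m)"
  by (induction n) (simp_all add: conj_mpoly_def lookup_map)

lemma conj_mpoly_funpow_eq_0_iff: "(conj_mpoly ^^ n) p = 0 \<longleftrightarrow> p = 0"
  by (induction n) (simp_all add: conj_mpoly_def map_eq_0_iff)

lemma total_degree_conj_mpoly_funpow: "total_degree ((conj_mpoly ^^ n) p) = total_degree p"
  by (induction n) (simp_all add: conj_mpoly_def total_degree_map)

lemma conj_mpoly_map_to_ac [simp]: "conj_mpoly (Poly_Mapping.map to_ac p) = Poly_Mapping.map to_ac p"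
  by (rule poly_mapping_eqI) (simp add: conj_mpoly_def lookup_map)

text \<open>Descent to the base field: coefficients fixed by \<open>frob\<close> lie in the range of
  \<open>to_ac\<close>.\<close>

lemma conj_mpoly_fixedE:
  assumes "conj_mpoly p = p"
  obtains p0 where "p = Poly_Mapping.map to_ac p0"
proof -
  have "frob (Poly_Mapping.lookup p m) = Poly_Mapping.lookup p m" for m
    using assms lookup_conj_mpoly_funpow[of 1 p m] by simp
  then have "Poly_Mapping.lookup p m \<in> range to_ac" for m
    unfolding frob_fixed_iff .
  then have "p = Poly_Mapping.map to_ac (Poly_Mapping.map of_ac p)"
    by (intro poly_mapping_eqI) (simp add: lookup_map to_ac_of_ac)
  then show thesis by (rule that)
qed

lemma map_to_ac_inj: "Poly_Mapping.map to_ac p = Poly_Mapping.map to_ac q \<longleftrightarrow> p = q"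
proof
  assume eq: "Poly_Mapping.map to_ac p = Poly_Mapping.map to_ac q"
  show "p = q"
  proof (rule poly_mapping_eqI)
    fix m
    have "to_ac (Poly_Mapping.lookup p m) = to_ac (Poly_Mapping.lookup q m)"
      using arg_cong[OF eq, of "\<lambda>r. Poly_Mapping.lookup r m"] by (simp add: lookup_map)
    then show "Poly_Mapping.lookup p m = Poly_Mapping.lookup q m" by simp
  qed
qed simp

lemma conj_mpoly_periodic: "\<exists>n>0. (conj_mpoly ^^ n) p = p"
proof -
  obtain N where N: "\<And>x :: 'b alg_closure. N x > 0 \<and> (frob ^^ N x) x = x"
    using frob_periodic by metis
  \<comment> \<open>Each of the finitely many coefficients has a period; their product is a common
    one.\<close>
  define n where "n = (\<Prod>m\<in>Poly_Mapping.keys p. N (Poly_Mapping.lookup p m))"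
  have "(frob ^^ n) (Poly_Mapping.lookup p m) = Poly_Mapping.lookup p m" for m
  proof (cases "m \<in> Poly_Mapping.keys p")
    case True
    let ?c = "Poly_Mapping.lookup p m"
    have "N ?c dvd n" unfolding n_def using True by (intro dvd_prodI) auto
    then obtain k where "n = N ?c * k" by blast
    moreover have "((frob ^^ N ?c) ^^ k) ?c = ?c" using N by (induction k) auto
    ultimately show ?thesis by (simp add: funpow_mult mult.commute)
  next
    case False
    have "(frob ^^ n) (0 :: 'b alg_closure) = 0" for n by (induction n) auto
    with False show ?thesis by (simp add: in_keys_iff)
  qed
  then have "(conj_mpoly ^^ n) p = p"
    by (intro poly_mapping_eqI) (simp add: lookup_conj_mpoly_funpow)
  moreover have "n > 0" unfolding n_def using N by (intro prod_pos) auto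
  ultimately show ?thesis by blast
qed

text \<open>The coordinates of the point lie in the base field, which \<open>frob\<close> fixes, so
  conjugating the polynomial conjugates its value.\<close>

lemma eval_conj_mpoly_funpow:
  "eval_mpoly (\<lambda>c. c) (\<lambda>k. to_ac (a k)) ((conj_mpoly ^^ n) p) =
    (frob ^^ n) (eval_mpoly (\<lambda>c. c) (\<lambda>k. to_ac (a k)) p)"
proof (induction n)
  case (Suc n)
  let ?e = "eval_mpoly (\<lambda>c. c) (\<lambda>k. to_ac (a k))"
  have "?e (conj_mpoly q) = frob (?e q)" for q
    unfolding conj_mpoly_def map_eq_eval_mpoly[OF ring_morphism_frob]
      ring_morphism.eval_mpoly[OF ring_morphism_eval_mpoly[OF ring_morphism_id]]
      ring_morphism.eval_mpoly[OF ring_morphism_frob]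
    by (simp add: eval_mpoly_Const eval_mpoly_Var ring_morphism_id)
  then show ?case using Suc by simp
qed simp

theorem irreducible_not_absolutely_irreducible_linear_factor:
  fixes P :: "('d::finite, 'a::{field, finite}) mpoly"
  assumes irr: "Factorial_Ring.irreducible P" and nabs: "\<not> absolutely_irreducible P"
    and deg: "Factorial_Ring.prime (total_degree P)"
  obtains f :: "('d, 'a alg_closure) mpoly" where "total_degree f = 1"
    "\<And>a. eval_mpoly (\<lambda>c. c) a P = 0 \<longleftrightarrow> eval_mpoly (\<lambda>c. c) (\<lambda>k. to_ac (a k)) f = 0"
proof -
  let ?PK = "Poly_Mapping.map to_ac P :: ('d, 'a alg_closure) mpoly"
  interpret ac: ring_morphism "Poly_Mapping.map to_ac :: ('d, 'a) mpoly \<Rightarrow> ('d, 'a alg_closure) mpoly"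
    by (intro ring_morphism_map ring_morphism_to_ac)
  have degPK: "total_degree ?PK = total_degree P" by (rule total_degree_map) simp
  have "P \<noteq> 0" using irr by (auto simp: Factorial_Ring.irreducible_def)
  then have PK0: "?PK \<noteq> 0" by (simp add: map_eq_0_iff)
  have "total_degree P > 0" using deg by (simp add: prime_gt_0_nat)
  then have "\<not> ?PK dvd 1" by (simp add: mpoly_is_unit_iff degPK)
  \<comment> \<open>\<open>?PK\<close> is nonzero and not a unit, so it can fail to be irreducible
    only through a proper factorization.\<close>
  then obtain A B where AB: "?PK = A * B" "\<not> A dvd 1" "\<not> B dvd 1"
    using nabs PK0 unfolding absolutely_irreducible_def Factorial_Ring.irreducible_def by blast
  have AB0: "A \<noteq> 0" "B \<noteq> 0" using AB PK0 by auto
  have degA: "total_degree A < total_degree P"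
    using AB AB0 total_degree_mult[OF AB0] degPK mpoly_is_unit_iff[of B] by simp
  obtain f1 where f1: "Factorial_Ring.irreducible f1" "f1 dvd A"
    using irreducible_factor_exists[OF AB0(1) AB(2)] by blast
  have f10: "f1 \<noteq> 0" using f1 by (auto simp: Factorial_Ring.irreducible_def)
  then obtain m where m: "m \<in> Poly_Mapping.keys f1" by (metis keys_eq_empty ex_in_conv)
  \<comment> \<open>Normalizing the coefficient at \<open>m\<close> to 1, which \<open>frob\<close>
    fixes, ensures that conjugates of \<open>f\<close> are associated only if they are
    equal.\<close>
  define d where "d = inverse (Poly_Mapping.lookup f1 m)"
  define f where "f = Const d * f1"
  have d0: "d \<noteq> 0" using m by (simp add: d_def in_keys_iff)
  have fm: "Poly_Mapping.lookup f m = 1"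
    using m by (simp add: f_def lookup_Const_mult d_def in_keys_iff)
  have f1_eq: "f1 = Const (inverse d) * f"
    unfolding f_def using d0
    by (intro poly_mapping_eqI) (simp add: lookup_Const_mult)
  have f0: "f \<noteq> 0" using fm by auto
  have "Const (inverse d) dvd (1 :: ('d, 'a alg_closure) mpoly)"
    using d0 by (simp add: mpoly_is_unit_iff)
  then have f1_dvd: "f dvd f1" and f_dvd1: "f1 dvd f"
    using f1_eq f_def by (metis dvd_triv_right)+
  have degf1: "total_degree f = total_degree f1"
    using total_degree_mult[of "Const d" f1] d0 f10 by (simp add: f_def)
  have degf_pos: "total_degree f > 0"
    using f1(1) f10 mpoly_is_unit_iff[of f1] degf1 unfolding Factorial_Ring.irreducible_def by simp
  have f_irr: "u dvd 1 \<or> v dvd 1" if "f = u * v" for u v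
  proof -
    have "f1 = (Const (inverse d) * u) * v" using f1_eq that by (simp add: mult.assoc)
    then have "Const (inverse d) * u dvd 1 \<or> v dvd 1"
      using f1(1) unfolding Factorial_Ring.irreducible_def by blast
    then show ?thesis using dvd_mult_right by blast
  qed
  have f_dvd: "f dvd ?PK" using f1_dvd f1(2) AB(1) by (metis dvd_trans dvd_triv_left)
  have degf: "total_degree f < total_degree P"
  proof -
    obtain c where "A = f1 * c" using f1(2) by blast
    then show ?thesis
      using total_degree_mult[of f1 c] AB0(1) mpoly_mult_eq_0_iff[of f1 c] degf1 degA by simp
  qed
  \<comment> \<open>The length of the orbit of \<open>f\<close> under conjugation.\<close>
  define n where "n = (LEAST n. n > 0 \<and> (conj_mpoly ^^ n) f = f)"
  have n: "n > 0" "(conj_mpoly ^^ n) f = f"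
    using LeastI_ex[OF conj_mpoly_periodic[of f]] unfolding n_def by auto
  have n_min: "(conj_mpoly ^^ k) f \<noteq> f" if "0 < k" "k < n" for k
    using that not_less_Least[of k "\<lambda>n. n > 0 \<and> (conj_mpoly ^^ n) f = f"] unfolding n_def by blast
  define g where "g i = (conj_mpoly ^^ i) f" for i
  have g0: "g i \<noteq> 0" and degg: "total_degree (g i) = total_degree f" for i
    using f0 by (simp_all add: g_def conj_mpoly_funpow_eq_0_iff total_degree_conj_mpoly_funpow)
  have PK_fixed: "(conj_mpoly ^^ i) ?PK = ?PK" for i
    by (induction i) auto
  have g_dvd: "g i dvd ?PK" for i
  proof -
    obtain c where "?PK = f * c" using f_dvd by blast
    then have "(conj_mpoly ^^ i) ?PK = g i * (conj_mpoly ^^ i) c"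
      unfolding g_def using ring_morphism.mult[OF ring_morphism_conj_mpoly_funpow] by metis
    then show ?thesis unfolding PK_fixed by simp
  qed
  \<comment> \<open>A factorization of \<open>g i\<close> is carried to one of \<open>f\<close> by
    the remaining \<open>n - i\<close> conjugations, which preserve degrees and hence units.\<close>
  have g_prime: "prime_elem (g i)" if "i < n" for i
  proof (rule irreducible_imp_prime_elem_mpoly, rule Factorial_Ring.irreducibleI)
    show "g i \<noteq> 0" by (rule g0)
    show "\<not> g i dvd 1" using degf_pos degg by (simp add: mpoly_is_unit_iff)
    fix u v assume uv: "g i = u * v"
    define k where "k = n - i"
    have "(conj_mpoly ^^ k) (g i) = f"
      unfolding g_def k_def using that n(2) by (metis comp_apply funpow_add le_add_diff_inverse2 less_imp_le)
    then have "f = (conj_mpoly ^^ k) u * (conj_mpoly ^^ k) v"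
      using uv ring_morphism.mult[OF ring_morphism_conj_mpoly_funpow] by metis
    then have "(conj_mpoly ^^ k) u dvd 1 \<or> (conj_mpoly ^^ k) v dvd 1" by (rule f_irr)
    then show "u dvd 1 \<or> v dvd 1"
      by (simp add: mpoly_is_unit_iff conj_mpoly_funpow_eq_0_iff total_degree_conj_mpoly_funpow)
  qed
  have frob1: "(frob ^^ i) (1 :: 'a alg_closure) = 1" for i
    by (induction i) (simp_all add: frob_def)
  \<comment> \<open>Undoing \<open>i\<close> conjugations would give \<open>g (j - i) = f\<close>
    with \<open>0 < j - i\<close> and \<open>j - i < n\<close>, against the choice of
    \<open>n\<close>.\<close>
  have g_ne: "g i \<noteq> g j" if "i < j" "j < n" for i j
  proof
    assume "g i = g j"
    moreover have "g j = (conj_mpoly ^^ i) (g (j - i))"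
      unfolding g_def using that by (metis comp_apply funpow_add le_add_diff_inverse less_imp_le)
    ultimately have "(conj_mpoly ^^ i) (g (j - i) - f) = 0"
      by (simp add: ring_morphism.diff[OF ring_morphism_conj_mpoly_funpow] g_def)
    then have "g (j - i) = f" by (simp add: conj_mpoly_funpow_eq_0_iff)
    then show False using n_min[of "j - i"] that unfolding g_def by simp
  qed
  \<comment> \<open>Equal degrees make the quotient a constant, and the coefficients at
    \<open>m\<close>, both 1, make that constant 1.\<close>
  have g_not_dvd: "\<not> g i dvd g j" if ij: "i < n" "j < n" "i \<noteq> j" for i j
  proof
    assume "g i dvd g j"
    then obtain c where c: "g j = g i * c" by blast
    then have "c \<noteq> 0" using g0 by auto
    moreover have "total_degree (g i * c) = total_degree f" using degg[of j] c by simp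
    ultimately have "total_degree c = 0"
      using total_degree_mult[OF g0, of c i] degg[of i] by simp
    then obtain e where e: "c = Const e" using total_degree_0E by blast
    have "Poly_Mapping.lookup (g j) m = e * Poly_Mapping.lookup (g i) m"
      using c e lookup_Const_mult[of e "g i" m] by (simp add: mult.commute)
    then have "e = 1" by (simp add: g_def lookup_conj_mpoly_funpow fm frob1)
    then have "g j = g i" using c e by (simp add: Const_def)
    then show False using g_ne[of i j] g_ne[of j i] ij by (metis linorder_neqE_nat)
  qed
  define N where "N = (\<Prod>i<n. g i)"
  have "N dvd ?PK"
    unfolding N_def using g_prime g_dvd g_not_dvd by (intro prod_prime_elems_dvd) auto
  then obtain Q where Q: "?PK = N * Q" by blast
  have NQ0: "N \<noteq> 0" "Q \<noteq> 0" using Q PK0 by auto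
  interpret conj: ring_morphism "conj_mpoly :: ('d, 'a alg_closure) mpoly \<Rightarrow> _"
    using ring_morphism_conj_mpoly_funpow[of 1] by simp
  \<comment> \<open>Conjugation shifts the factors cyclically, since \<open>g n = g 0\<close>;
    cancelling \<open>g 0\<close> shows that \<open>N\<close> is fixed.\<close>
  have "conj_mpoly N = (\<Prod>i<n. g (Suc i))"
    unfolding N_def conj.prod by (simp add: g_def)
  also have "\<dots> = N"
  proof -
    have "g 0 * (\<Prod>i<n. g (Suc i)) = (\<Prod>i<Suc n. g i)" by (simp only: prod.lessThan_Suc_shift)
    also have "\<dots> = g 0 * N" using n by (simp add: N_def g_def mult.commute)
    finally show ?thesis using mpoly_mult_left_cancel[OF g0] by blast
  qed
  finally have conjN: "conj_mpoly N = N" .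
  have "N * conj_mpoly Q = N * Q"
    using conj_mpoly_map_to_ac[of P] unfolding Q conj.mult conjN .
  then have conjQ: "conj_mpoly Q = Q" using mpoly_mult_left_cancel[OF NQ0(1)] by blast
  obtain N0 where N0: "N = Poly_Mapping.map to_ac N0" using conj_mpoly_fixedE[OF conjN] .
  obtain Q0 where Q0: "Q = Poly_Mapping.map to_ac Q0" using conj_mpoly_fixedE[OF conjQ] .
  \<comment> \<open>Both factors descend to the base field, where \<open>P\<close> is irreducible;
    \<open>N\<close> is not constant, so \<open>Q\<close> must be.\<close>
  have "P = N0 * Q0" using Q unfolding N0 Q0 ac.mult[symmetric] map_to_ac_inj .
  then have "N0 dvd 1 \<or> Q0 dvd 1" using irr unfolding Factorial_Ring.irreducible_def by blast
  then have "total_degree N = 0 \<or> total_degree Q = 0"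
    unfolding N0 Q0 by (auto simp: mpoly_is_unit_iff total_degree_map)
  moreover have degN: "total_degree N = n * total_degree f"
  proof -
    have "(\<Prod>i<k. g i) \<noteq> 0 \<and> total_degree (\<Prod>i<k. g i) = k * total_degree f" for k
    proof (induction k)
      case 0
      show ?case by (simp add: total_degree_def monomial_degree_def)
    next
      case (Suc k)
      then show ?case using g0[of k] by (simp add: total_degree_mult mpoly_mult_eq_0_iff degg)
    qed
    then show ?thesis by (simp add: N_def)
  qed
  ultimately have degQ: "total_degree Q = 0" using n degf_pos by auto
  have "total_degree P = n * total_degree f"
    using total_degree_mult[OF NQ0] Q degPK degN degQ by simp
  \<comment> \<open>The degree of \<open>f\<close> divides the prime \<open>total_degree P\<close>
    and is smaller, so it is 1.\<close>
  then have "total_degree f = 1"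
    using deg degf by (metis dvd_triv_right prime_nat_iff less_irrefl)
  moreover have "eval_mpoly (\<lambda>c. c) a P = 0 \<longleftrightarrow> eval_mpoly (\<lambda>c. c) (\<lambda>k. to_ac (a k)) f = 0" for a
  proof -
    let ?e = "eval_mpoly (\<lambda>c. c) (\<lambda>k. to_ac (a k)) :: ('d, 'a alg_closure) mpoly \<Rightarrow> _"
    interpret e: ring_morphism ?e
      by (intro ring_morphism_eval_mpoly ring_morphism_id)
    obtain c where c: "Q = Const c" using total_degree_0E[OF degQ] .
    have eQ: "?e Q \<noteq> 0" using c NQ0(2) by (auto simp: eval_mpoly_Const ring_morphism_id)
    have "?e ?PK = to_ac (eval_mpoly (\<lambda>c. c) a P)"
      unfolding map_eq_eval_mpoly[OF ring_morphism_to_ac] e.eval_mpoly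
        ring_morphism.eval_mpoly[OF ring_morphism_to_ac]
      by (simp add: eval_mpoly_Const eval_mpoly_Var ring_morphism_id)
    then have "eval_mpoly (\<lambda>c. c) a P = 0 \<longleftrightarrow> ?e ?PK = 0" by simp
    \<comment> \<open>\<open>Q\<close> is a nonzero constant, so only the factors \<open>g i\<close>
      can vanish. Their values are iterates of \<open>frob\<close> on the value of \<open>f\<close>
      and vanish together.\<close>
    also have "\<dots> \<longleftrightarrow> (\<exists>i<n. ?e (g i) = 0)"
      unfolding Q e.mult using eQ by (auto simp: N_def e.prod)
    also have "\<dots> \<longleftrightarrow> ?e f = 0"
    proof -
      have "(frob ^^ i) x = 0 \<longleftrightarrow> x = 0" for i and x :: "'a alg_closure"
        by (induction i) auto
      then show ?thesis using n(1) by (auto simp: g_def eval_conj_mpoly_funpow)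
    qed
    finally show ?thesis .
  qed
  ultimately show thesis by (rule that)
qed

section \<open>Determinantal polynomials\<close>

lemma det_scale_all:
  fixes E :: "'a::comm_ring_1 ^ 'n ^ 'n"
  shows "det (\<chi> i j. t * E $ i $ j) = t ^ CARD('n) * det E"
  unfolding det_def by (simp add: prod.distrib sum_distrib_left mult_ac)

lemma determinantal_poly_entry:
  "(\<Sum>k\<in>UNIV. Var k *\<^sub>m map_matrix Const (B k)) $ i $ j = (\<Sum>k\<in>UNIV. Var k * Const (B k $ i $ j))"
  by (simp add: mat_scale_def map_matrix_def)

text \<open>Used for evaluation at a point, which yields the determinant of a matrix in the space,
  and for \<open>grade\<close>, which yields the degree.\<close>

lemma ring_morphism_determinantal_poly:
  assumes "ring_morphism h"
  shows "h (determinantal_poly B) = det (\<chi> i j. \<Sum>k\<in>UNIV. h (Var k) * h (Const (B k $ i $ j)))"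
proof -
  interpret h: ring_morphism h by fact
  show ?thesis
    unfolding determinantal_poly_def h.det determinantal_poly_entry by (simp add: h.sum h.mult)
qed

text \<open>\<open>grade\<close> puts the same factor t on every entry, hence t^n on the determinant
  for n = \<open>CARD('n)\<close>; what remains is constant in t and nonzero by assumption.\<close>

lemma total_degree_determinantal_poly:
  fixes B :: "'d::finite \<Rightarrow> 'a::field ^ 'n ^ 'n"
  assumes "determinantal_poly B \<noteq> 0"
  shows "total_degree (determinantal_poly B) = CARD('n)"
proof -
  define E :: "(nat, 'a) mpoly ^ 'n ^ 'n"
    where "E = (\<chi> i j. \<Sum>k\<in>UNIV. Var (to_nat k) * Const (B k $ i $ j))"
  have gr: "grade (Const c) = [:Const c:]" "grade (Var k) = monom 1 1 * [:Var (to_nat k):]"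
    for c :: 'a and k :: 'd
    unfolding grade_def
    by (simp_all add: eval_mpoly_Const eval_mpoly_Var ring_morphism_Const smult_monom
        ring_morphism_comp[OF ring_morphism_const_poly])
  have "grade (determinantal_poly B) = det (\<chi> i j. monom 1 1 * (\<chi> i j. [:E $ i $ j:]) $ i $ j)"
    unfolding ring_morphism_determinantal_poly[OF ring_morphism_grade] gr E_def
    by (simp add: ring_morphism.sum[OF ring_morphism_const_poly] sum_distrib_left mult_ac smult_monom)
  also have "\<dots> = monom 1 1 ^ CARD('n) * [:det E:]"
    unfolding det_scale_all ring_morphism.det[OF ring_morphism_const_poly] ..
  finally have eq: "grade (determinantal_poly B) = monom 1 (CARD('n)) * [:det E:]"
    by (simp add: monom_power)
  then have "det E \<noteq> 0" using assms grade_eq_0_iff[of "determinantal_poly B"] by auto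
  then have "degree (grade (determinantal_poly B)) = CARD('n)"
    unfolding eq by (simp add: degree_mult_eq Polynomial.degree_monom_eq)
  then show ?thesis by (simp add: degree_grade)
qed

section \<open>Polynomials of degree one as linear forms\<close>

lemma monomial_degree_le_1:
  assumes "monomial_degree m \<le> 1" "m \<noteq> 0"
  obtains i where "m = Poly_Mapping.single i 1"
proof -
  obtain i where i: "i \<in> Poly_Mapping.keys m"
    using assms(2) by (metis keys_eq_empty ex_in_conv)
  have "monomial_degree m = Poly_Mapping.lookup m i + (\<Sum>j\<in>Poly_Mapping.keys m - {i}. Poly_Mapping.lookup m j)"
    unfolding monomial_degree_def by (rule sum.remove[OF _ i]) simp
  moreover have "Poly_Mapping.lookup m i > 0" using i by (simp add: in_keys_iff)
  ultimately have i1: "Poly_Mapping.lookup m i = 1"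
    and rest: "(\<Sum>j\<in>Poly_Mapping.keys m - {i}. Poly_Mapping.lookup m j) = 0"
    using assms(1) by linarith+
  have "Poly_Mapping.lookup m j = 0" if "j \<noteq> i" for j
  proof (cases "j \<in> Poly_Mapping.keys m")
    case True
    then have "Poly_Mapping.lookup m j \<le> (\<Sum>j\<in>Poly_Mapping.keys m - {i}. Poly_Mapping.lookup m j)"
      using that by (intro member_le_sum) auto
    then show ?thesis using rest by linarith
  qed (simp add: in_keys_iff)
  then have "m = Poly_Mapping.single i 1"
    using i1 by (intro poly_mapping_eqI) (auto simp: lookup_single when_def)
  then show thesis by (rule that)
qed

text \<open>Vanishing at the origin removes the constant term, so every monomial left in
  \<open>f\<close> is a single variable.\<close>

lemma eval_mpoly_linear:
  fixes f :: "('i, 'a::comm_ring_1) mpoly"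
  assumes deg: "total_degree f \<le> 1" and zero: "eval_mpoly (\<lambda>c. c) (\<lambda>_. 0) f = 0"
  shows "eval_mpoly (\<lambda>c. c) (\<lambda>i. x i + y i) f = eval_mpoly (\<lambda>c. c) x f + eval_mpoly (\<lambda>c. c) y f"
    and "eval_mpoly (\<lambda>c. c) (\<lambda>i. a * x i) f = a * eval_mpoly (\<lambda>c. c) x f"
proof -
  have single: "m = 0 \<or> (\<exists>i. m = Poly_Mapping.single i 1)" if "m \<in> Poly_Mapping.keys f" for m
    using monomial_degree_le[OF that] deg monomial_degree_le_1[of m] by (metis order.trans)
  have "eval_mpoly (\<lambda>c. c) (\<lambda>_. 0) f = (\<Sum>m\<in>Poly_Mapping.keys f. if m = 0 then Poly_Mapping.lookup f m else 0)"
    unfolding eval_mpoly_def by (intro sum.cong) (auto dest!: single)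
  also have "\<dots> = Poly_Mapping.lookup f 0" by (simp add: sum.delta' in_keys_iff)
  finally have "Poly_Mapping.lookup f 0 = 0" using zero by simp
  then have single: "\<exists>i. m = Poly_Mapping.single i 1" if "m \<in> Poly_Mapping.keys f" for m
    using single[OF that] that by (auto simp: in_keys_iff)
  show "eval_mpoly (\<lambda>c. c) (\<lambda>i. x i + y i) f = eval_mpoly (\<lambda>c. c) x f + eval_mpoly (\<lambda>c. c) y f"
    unfolding eval_mpoly_def sum.distrib[symmetric]
    by (intro sum.cong) (auto simp: distrib_left dest!: single)
  show "eval_mpoly (\<lambda>c. c) (\<lambda>i. a * x i) f = a * eval_mpoly (\<lambda>c. c) x f"
    unfolding eval_mpoly_def sum_distrib_left
    by (intro sum.cong) (auto simp: mult_ac dest!: single)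
qed

theorem theorem3:
  fixes M :: "('a::{field, finite} ^ 'r ^ 'r) set"
    and B :: "'d::finite \<Rightarrow> 'a ^ 'r ^ 'r"
  assumes "Factorial_Ring.prime CARD('r)"
    and "mat_space.subspace M"
    and "is_basis_of B M"
    and "Factorial_Ring.irreducible (determinantal_poly B)"
    and "\<not> absolutely_irreducible (determinantal_poly B)"
  shows "mat_space.subspace {A \<in> M. det A = 0}"
proof -
  \<comment> \<open>\<open>L\<close> turns coordinates with respect to \<open>B\<close> into
    matrices; its range is \<open>M\<close>.\<close>
  define L where "L a = (\<Sum>k\<in>UNIV. a k *\<^sub>m B k)" for a :: "'d \<Rightarrow> 'a"
  have L_entry: "L a $ i $ j = (\<Sum>k\<in>UNIV. a k * B k $ i $ j)" for a i j
    by (simp add: L_def mat_scale_def)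
  have M_eq: "M = range L"
  proof -
    have "inj B" and M: "M = mat_space.span (range B)"
      using assms(3) unfolding is_basis_of_def by auto
    have "L a \<in> M" for a
      unfolding L_def M
      by (intro mat_space.span_sum mat_space.span_scale mat_space.span_base) auto
    moreover have "A \<in> range L" if "A \<in> M" for A
    proof -
      have "A \<in> range (\<lambda>u. \<Sum>v\<in>range B. u v *\<^sub>m v)"
        using that unfolding M by (subst (asm) mat_space.span_finite) auto
      then obtain u where "A = (\<Sum>v\<in>range B. u v *\<^sub>m v)" by blast
      also have "\<dots> = L (\<lambda>k. u (B k))"
        unfolding L_def using \<open>inj B\<close> by (simp add: sum.reindex)
      finally show ?thesis by blast
    qed
    ultimately show ?thesis by blast
  qed
  let ?P = "determinantal_poly B"
  have det_L: "det (L a) = eval_mpoly (\<lambda>c. c) a ?P" for a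
  proof -
    have "det (L a) = det (\<chi> i j. \<Sum>k\<in>UNIV. a k * B k $ i $ j)"
      by (rule arg_cong[of _ _ det]) (simp add: vec_eq_iff L_entry)
    then show ?thesis
      by (simp add: ring_morphism_determinantal_poly ring_morphism_eval_mpoly ring_morphism_id
          eval_mpoly_Const eval_mpoly_Var)
  qed
  have "?P \<noteq> 0" using assms(4) by (auto simp: Factorial_Ring.irreducible_def)
  then have "Factorial_Ring.prime (total_degree ?P)"
    using assms(1) by (simp add: total_degree_determinantal_poly)
  then obtain f :: "('d, 'a alg_closure) mpoly" where f: "total_degree f = 1"
    "\<And>a. eval_mpoly (\<lambda>c. c) a ?P = 0 \<longleftrightarrow> eval_mpoly (\<lambda>c. c) (\<lambda>k. to_ac (a k)) f = 0"
    using irreducible_not_absolutely_irreducible_linear_factor[OF assms(4,5)] by blast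
  define l where "l a = eval_mpoly (\<lambda>c. c) (\<lambda>k. to_ac (a k)) f" for a :: "'d \<Rightarrow> 'a"
  have det_iff: "det (L a) = 0 \<longleftrightarrow> l a = 0" for a
    unfolding det_L l_def by (rule f(2))
  have L0: "L (\<lambda>_. 0) = 0" by (simp add: vec_eq_iff L_entry)
  \<comment> \<open>The zero matrix is singular, so \<open>l\<close> vanishes at the origin; hence
    \<open>f\<close>, of degree 1, has no constant term and \<open>l\<close> is linear over the base
    field.\<close>
  have "det (0 :: 'a ^ 'r ^ 'r) = 0"
    by (simp add: det_def zero_power_eq)
  then have "l (\<lambda>_. 0) = 0" using det_iff[of "\<lambda>_. 0"] L0 by simp
  then have zero: "eval_mpoly (\<lambda>c. c) (\<lambda>_. 0) f = 0" by (simp add: l_def)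
  note linear = eval_mpoly_linear[OF eq_refl[OF f(1)] zero]
  have l_add: "l (\<lambda>k. a k + b k) = l a + l b" for a b
    using linear(1) by (simp add: l_def)
  have l_scale: "l (\<lambda>k. c * a k) = to_ac c * l a" for a c
    using linear(2) by (simp add: l_def)
  \<comment> \<open>The singular matrices are the image under \<open>L\<close> of the kernel of
    \<open>l\<close>, and both maps are linear.\<close>
  have Z: "{A \<in> M. det A = 0} = L ` {a. l a = 0}"
    unfolding M_eq using det_iff by auto
  show ?thesis
    unfolding Z
  proof (rule mat_space.subspaceI)
    show "0 \<in> L ` {a. l a = 0}"
      using L0 \<open>l (\<lambda>_. 0) = 0\<close> by (intro image_eqI[of _ _ "\<lambda>_. 0"]) auto
  next
    fix A C assume "A \<in> L ` {a. l a = 0}" "C \<in> L ` {a. l a = 0}"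
    then obtain a b where ab: "A = L a" "l a = 0" "C = L b" "l b = 0" by blast
    have "A + C = L (\<lambda>k. a k + b k)"
      unfolding ab by (simp add: vec_eq_iff L_entry distrib_right sum.distrib)
    then show "A + C \<in> L ` {a. l a = 0}" using l_add ab by auto
  next
    fix c A assume "A \<in> L ` {a. l a = 0}"
    then obtain a where a: "A = L a" "l a = 0" by blast
    have "c *\<^sub>m A = L (\<lambda>k. c * a k)"
      unfolding a by (simp add: vec_eq_iff L_entry mat_scale_def sum_distrib_left mult.assoc)
    then show "c *\<^sub>m A \<in> L ` {a. l a = 0}" using l_scale a by auto
  qed
qed

end
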